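(* There is no connected compact embedded translator $M$ in $\mathbb{R}^{m+1}$ whose boundary is contained in a hyperplane $P$ orthogonal to the direction of translation $\mathrm{v}$ and consists of two strictly convex Jordan curves (closed strictly convex hypersurfaces of $P$, curves when $m=2$) $\Gamma_1,\Gamma_2$ such that $\operatorname{dist}(\Gamma_1,\Gamma_2)\ge\pi$ and neither of them is contained in the region of $P$ enclosed by the other.
   Context: A translator is an oriented smooth hypersurface $f:M^m\to\mathbb{R}^{m+1}$ (possibly with boundary) whose mean curvature vector $\mathbf{H}$ satisfies $\mathbf{H}=\mathrm{v}^\perp$, where $\mathrm{v}$ is a fixed unit vector (the direction of translation) and $\mathrm{v}^\perp$ its orthogonal projection onto the normal bundle. *)

theory Defs
  imports "HOL-Analysis.Analysis"
begin

text \<open>C-infinity smoothness on an open set: differentiable, and all first partial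
  derivatives are again smooth (greatest fixed point = derivatives of all orders).\<close>
coinductive smooth_on :: "'a::euclidean_space set \<Rightarrow> ('a \<Rightarrow> 'b::real_normed_vector) \<Rightarrow> bool"
  for U :: "'a set" where
  "f differentiable_on U \<Longrightarrow> (\<forall>b\<in>Basis. smooth_on U (\<lambda>x. frechet_derivative f (at x) b))
   \<Longrightarrow> smooth_on U f"

definition hyperplane0 :: "'a::euclidean_space \<Rightarrow> 'a set" where
  "hyperplane0 e = {x. x \<bullet> e = 0}"

definition proj_perp :: "'a::euclidean_space \<Rightarrow> 'a \<Rightarrow> 'a" where
  "proj_perp e y = y - (y \<bullet> e) *\<^sub>R e"

definition grad :: "('a::euclidean_space \<Rightarrow> real) \<Rightarrow> 'a \<Rightarrow> 'a" where
  "grad f x = (\<Sum>b\<in>Basis. frechet_derivative f (at x) b *\<^sub>R b)"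

definition div_field :: "('a::euclidean_space \<Rightarrow> 'a) \<Rightarrow> 'a \<Rightarrow> real" where
  "div_field X x = (\<Sum>b\<in>Basis. frechet_derivative X (at x) b \<bullet> b)"

definition graph_pt :: "'a::euclidean_space \<Rightarrow> ('a \<Rightarrow> real) \<Rightarrow> 'a \<Rightarrow> 'a" where
  "graph_pt e u x = x + u x *\<^sub>R e"

definition graph_normal :: "'a::euclidean_space \<Rightarrow> ('a \<Rightarrow> real) \<Rightarrow> 'a \<Rightarrow> 'a" where
  "graph_normal e u x = e - grad (u \<circ> proj_perp e) x"

text \<open>Translator equation H = v^perp for the graph: the mean curvature vector of the graph
  is div(grad u / W) nu with nu = (e - grad u)/W, W = sqrt(1+|grad u|^2), so H = v^perp
  means div(grad u / W) = <v, nu>.\<close>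
definition translator_eq :: "'a::euclidean_space \<Rightarrow> 'a \<Rightarrow> ('a \<Rightarrow> real) \<Rightarrow> 'a \<Rightarrow> bool" where
  "translator_eq v e u x \<longleftrightarrow>
     (let w = u \<circ> proj_perp e; W = (\<lambda>y. sqrt (1 + (norm (grad w y))\<^sup>2))
      in div_field (\<lambda>y. grad w y /\<^sub>R W y) x = (v \<bullet> graph_normal e u x) / W x)"

definition graph_chart :: "'a::euclidean_space set \<Rightarrow> 'a \<Rightarrow> 'a \<Rightarrow> real \<Rightarrow> 'a set
     \<Rightarrow> ('a \<Rightarrow> real) \<Rightarrow> 'a set \<Rightarrow> bool" where
  "graph_chart M p e r U u D \<longleftrightarrow> p \<in> M \<and> norm e = 1 \<and> r > 0 \<and> open U \<and> smooth_on U u \<and>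
     D \<subseteq> U \<inter> hyperplane0 e \<and> M \<inter> ball p r = graph_pt e u ` D \<inter> ball p r"

definition interior_chart :: "'a::euclidean_space set \<Rightarrow> 'a \<Rightarrow> 'a \<Rightarrow> real \<Rightarrow> 'a set
     \<Rightarrow> ('a \<Rightarrow> real) \<Rightarrow> 'a set \<Rightarrow> bool" where
  "interior_chart M p e r U u D \<longleftrightarrow> D = U \<inter> hyperplane0 e \<and> graph_chart M p e r U u D"

definition boundary_chart :: "'a::euclidean_space set \<Rightarrow> 'a \<Rightarrow> 'a \<Rightarrow> real \<Rightarrow> 'a set
     \<Rightarrow> ('a \<Rightarrow> real) \<Rightarrow> 'a set \<Rightarrow> bool" where
  "boundary_chart M p e r U u D \<longleftrightarrow>
     (\<exists>\<phi>. smooth_on U \<phi> \<and> D = {x \<in> U \<inter> hyperplane0 e. \<phi> x \<ge> 0} \<and>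
        (\<forall>x\<in>U \<inter> hyperplane0 e. grad (\<phi> \<circ> proj_perp e) x \<noteq> 0) \<and>
        (\<exists>x0\<in>U \<inter> hyperplane0 e. \<phi> x0 = 0 \<and> p = graph_pt e u x0)) \<and>
     graph_chart M p e r U u D"

definition mfd_boundary :: "'a::euclidean_space set \<Rightarrow> 'a set" where
  "mfd_boundary M = {p \<in> M. \<not> (\<exists>e r U u D. interior_chart M p e r U u D)}"

definition translator :: "'a::euclidean_space \<Rightarrow> 'a set \<Rightarrow> bool" where
  "translator v M \<longleftrightarrow>
     (\<exists>N. continuous_on M N \<and> (\<forall>p\<in>M. norm (N p) = 1) \<and>
       (\<forall>p\<in>M. \<exists>e r U u D.
          (interior_chart M p e r U u D \<or> boundary_chart M p e r U u D) \<and>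
          (\<forall>x\<in>D. graph_pt e u x \<in> ball p r \<longrightarrow>
             translator_eq v e u x \<and> (\<exists>s. N (graph_pt e u x) = s *\<^sub>R graph_normal e u x))))"

definition strictly_convex_hypersurface_of :: "'a::euclidean_space set \<Rightarrow> 'a set \<Rightarrow> 'a set \<Rightarrow> bool" where
  "strictly_convex_hypersurface_of P K \<Gamma> \<longleftrightarrow>
     compact K \<and> convex K \<and> affine hull K = P \<and>
     (\<forall>x\<in>K. \<forall>y\<in>K. x \<noteq> y \<longrightarrow> open_segment x y \<subseteq> rel_interior K) \<and>
     \<Gamma> = rel_frontier K"

end

(* Let K1, K2 be the convex bodies bounded by the two curves. They are disjoint and at distance at
   least pi, so a slab of width pi lies between them, and by connectedness M enters it. Sliding a
   grim reaper cylinder inside this slab until it touches M would contradict the maximum principle,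
   but only in its strong form. Since the dimension is at least 3 there is a direction b orthogonal
   to the translation and to the slab normal a; adding a small multiple of (q . b)^2 to
   q . v + ln (cos (q . a - y0)) makes the barrier strict, so the second derivative test at a maximum
   over M already gives a contradiction. The function tends to minus infinity at the faces of the
   slab, hence the maximum exists and is attained away from the boundary of M.

   A point outside the manifold boundary has some interior chart, but the translator equation may
   be given there in a boundary chart. The interior chart makes the point critical along all of the
   tangent space; the second order condition then holds for the directions pointing into the
   boundary chart, and by evenness and continuity of quadratic forms for all directions. *)

theory Submission
  imports Defs
begin

section \<open>One-sided derivative tests on the real line\<close>

text \<open>A curve issuing from a boundary chart is only known to stay in \<open>M\<close> for
  positive times, so maximality is assumed on the right of 0. A positive derivative would force
  larger values there.\<close>

lemma DERIV_nonpos_if_right_max: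
  fixes f :: "real \<Rightarrow> real"
  assumes "(f has_real_derivative d) (at 0)" and "\<forall>\<^sub>F t in at_right 0. f t \<le> f 0"
  shows "d \<le> 0"
proof (rule ccontr)
  assume "\<not> d \<le> 0"
  then obtain \<delta> where \<delta>: "\<delta> > 0" "\<And>h. 0 < h \<Longrightarrow> h < \<delta> \<Longrightarrow> f 0 < f (0 + h)"
    using DERIV_pos_inc_right[OF assms(1)] by auto
  obtain b where "b > 0" "\<And>t. 0 < t \<Longrightarrow> t < b \<Longrightarrow> f t \<le> f 0"
    using assms(2) unfolding eventually_at_right_field by auto
  moreover have "0 < min \<delta> b / 2" "min \<delta> b / 2 < \<delta>" "min \<delta> b / 2 < b"
    using \<delta>(1) \<open>b > 0\<close> by auto
  ultimately show False
    using \<delta>(2)[of "min \<delta> b / 2"] by (simp add: not_less[symmetric])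
qed

lemma DERIV_eq_0_if_right_const:
  fixes f :: "real \<Rightarrow> real"
  assumes "(f has_real_derivative d) (at 0)" and "\<forall>\<^sub>F t in at_right 0. f t = f 0"
  shows "d = 0"
proof -
  have "d \<le> 0"
    by (rule DERIV_nonpos_if_right_max[OF assms(1)]) (use assms(2) in eventually_elim, simp)
  moreover have "- d \<le> 0"
    by (rule DERIV_nonpos_if_right_max[OF DERIV_minus[OF assms(1)]])
      (use assms(2) in eventually_elim, simp)
  ultimately show ?thesis by simp
qed

text \<open>If \<open>d\<close> were positive, \<open>f'\<close> would be positive just to the right
  of 0, and the mean value theorem would lift \<open>f\<close> above \<open>f 0\<close> there.
  Asking for derivatives on both sides is harmless: graph curves are defined for both signs of the
  parameter, even where they leave \<open>M\<close>.\<close>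

lemma DERIV2_nonpos_if_right_max:
  fixes f :: "real \<Rightarrow> real"
  assumes f: "\<forall>\<^sub>F t in nhds 0. (f has_real_derivative f' t) (at t)"
    and f': "(f' has_real_derivative d) (at 0)" "f' 0 = 0"
    and max: "\<forall>\<^sub>F t in at_right 0. f t \<le> f 0"
  shows "d \<le> 0"
proof (rule ccontr)
  assume "\<not> d \<le> 0"
  then obtain \<delta> where \<delta>: "\<delta> > 0" "\<And>h. 0 < h \<Longrightarrow> h < \<delta> \<Longrightarrow> 0 < f' h"
    using DERIV_pos_inc_right[OF f'(1)] f'(2) by auto
  obtain b where b: "b > 0" "\<And>t. 0 < t \<Longrightarrow> t < b \<Longrightarrow> f t \<le> f 0"
    using max unfolding eventually_at_right_field by auto
  obtain c where c: "c > 0" "\<And>t. \<bar>t\<bar> < c \<Longrightarrow> (f has_real_derivative f' t) (at t)"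
    using f unfolding eventually_nhds_metric by (auto simp: dist_real_def)
  define h where "h = min \<delta> (min b c) / 2"
  have h: "0 < h" "h < \<delta>" "h < b" "h < c"
    using \<delta>(1) b(1) c(1) by (auto simp: h_def)
  obtain z where z: "0 < z" "z < h" "f h - f 0 = (h - 0) * f' z"
    using MVT2[of 0 h f f'] h c(2) by force
  have "0 < h * f' z" using \<delta>(2)[of z] z h by simp
  then show False using z(3) b(2)[of h] h by simp
qed

section \<open>Height functions over a hyperplane: gradient and Hessian\<close>

lemma linear_proj_perp: "linear (proj_perp e)"
  by (rule linearI) (auto simp: proj_perp_def algebra_simps scaleR_add_left)

lemma bounded_linear_proj_perp: "bounded_linear (proj_perp e)"
  by (simp add: linear_conv_bounded_linear[symmetric] linear_proj_perp)

lemma proj_perp_inner: "norm e = 1 \<Longrightarrow> proj_perp e x \<bullet> e = 0"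
  by (simp add: proj_perp_def inner_diff_left norm_eq_sqrt_inner)

lemma proj_perp_idem: "x \<bullet> e = 0 \<Longrightarrow> proj_perp e x = x"
  by (simp add: proj_perp_def)

lemma grad_eqI:
  fixes f :: "'a::euclidean_space \<Rightarrow> real"
  assumes "(f has_derivative f') (at x)"
  shows "grad f x \<bullet> h = f' h"
proof -
  interpret bounded_linear f' using assms by (rule has_derivative_bounded_linear)
  have "frechet_derivative f (at x) = f'"
    using frechet_derivative_at[OF assms] by simp
  then have "grad f x \<bullet> h = (\<Sum>b\<in>Basis. (h \<bullet> b) * f' b)"
    by (simp add: grad_def inner_sum_left inner_commute[of _ h] inner_sum_right mult.commute)
  also have "\<dots> = f' (\<Sum>b\<in>Basis. (h \<bullet> b) *\<^sub>R b)"
    by (simp add: sum scaleR)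
  finally show ?thesis by (simp add: euclidean_representation)
qed

lemma has_derivative_grad:
  fixes f :: "'a::euclidean_space \<Rightarrow> real"
  assumes "f differentiable (at x)"
  shows "(f has_derivative (\<lambda>h. grad f x \<bullet> h)) (at x)"
proof -
  obtain f' where f': "(f has_derivative f') (at x)"
    using assms unfolding differentiable_def by auto
  then show ?thesis using grad_eqI[OF f'] by simp
qed

context
  fixes e :: "'a::euclidean_space" and U :: "'a set" and u :: "'a \<Rightarrow> real"
  assumes e: "norm e = 1" and U: "open U" and u: "smooth_on U u"
begin

lemma smooth_on_differentiable:
  assumes "x \<in> U"
  shows "u differentiable (at x)"
    and "\<And>b. b \<in> Basis \<Longrightarrow> (\<lambda>x. frechet_derivative u (at x) b) differentiable (at x)"
proof -
  have *: "u differentiable_on U" "\<forall>b\<in>Basis. smooth_on U (\<lambda>x. frechet_derivative u (at x) b)"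
    using u by (auto elim: smooth_on.cases)
  show "u differentiable (at x)"
    using *(1) assms U by (auto simp: differentiable_on_def at_within_open[OF assms U])
  fix b :: 'a assume "b \<in> Basis"
  then have "(\<lambda>x. frechet_derivative u (at x) b) differentiable_on U"
    using *(2) by (auto elim: smooth_on.cases)
  then show "(\<lambda>x. frechet_derivative u (at x) b) differentiable (at x)"
    using assms U by (auto simp: differentiable_on_def at_within_open[OF assms U])
qed

lemma has_derivative_comp_proj_perp:
  assumes "proj_perp e x \<in> U"
  shows "((u \<circ> proj_perp e) has_derivative (\<lambda>h. grad u (proj_perp e x) \<bullet> proj_perp e h)) (at x)"
  unfolding o_def
  by (rule has_derivative_compose[OF bounded_linear.has_derivative[OF bounded_linear_proj_perp
        has_derivative_ident]])
    (rule has_derivative_grad[OF smooth_on_differentiable(1)[OF assms]])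

text \<open>The translator equation uses the extension of \<open>u\<close> that is constant along
  \<open>e\<close>. The chain rule projects the direction of differentiation, and the self-adjoint
  projection can be moved onto the gradient.\<close>

lemma grad_comp_proj_perp:
  assumes "proj_perp e x \<in> U"
  shows "grad (u \<circ> proj_perp e) x = proj_perp e (grad u (proj_perp e x))"
  by (rule euclidean_eqI, subst grad_eqI[OF has_derivative_comp_proj_perp[OF assms]])
    (simp add: proj_perp_def inner_diff_left inner_diff_right inner_commute mult.commute)

lemma open_vimage_proj_perp: "open (proj_perp e -` U)"
  by (rule open_vimage[OF U]) (rule linear_continuous_on[OF bounded_linear_proj_perp])

lemma grad_comp_proj_perp_differentiable:
  assumes "proj_perp e x \<in> U"
  shows "grad (u \<circ> proj_perp e) differentiable (at x)"
proof -
  have "grad u differentiable (at (proj_perp e x))"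
    unfolding grad_def
    using smooth_on_differentiable(2)[OF assms]
    by (intro differentiable_sum ballI differentiable_scaleR differentiable_const) auto
  then obtain B where "(grad u has_derivative B) (at (proj_perp e x))"
    unfolding differentiable_def by blast
  then have "((\<lambda>x. grad u (proj_perp e x)) has_derivative (\<lambda>h. B (proj_perp e h))) (at x)"
    by (intro has_derivative_compose[OF bounded_linear.has_derivative[OF bounded_linear_proj_perp
        has_derivative_ident]])
  then have "((\<lambda>x. proj_perp e (grad u (proj_perp e x))) has_derivative
      (\<lambda>h. proj_perp e (B (proj_perp e h)))) (at x)"
    by (rule bounded_linear.has_derivative[OF bounded_linear_proj_perp])
  then have "(grad (u \<circ> proj_perp e) has_derivative (\<lambda>h. proj_perp e (B (proj_perp e h)))) (at x)"
    by (rule has_derivative_transform_within_open[OF _ open_vimage_proj_perp])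
      (use assms in \<open>auto simp: grad_comp_proj_perp\<close>)
  then show ?thesis unfolding differentiable_def by blast
qed

text \<open>The gradient field is orthogonal to \<open>e\<close> and constant along
  \<open>e\<close>. Differentiating these two identities on an open set, with uniqueness of
  derivatives, shows that the Hessian \<open>A\<close> lives on the hyperplane.\<close>

lemma hessian_comp_proj_perp:
  assumes "x \<in> U" "x \<bullet> e = 0"
  obtains A where "(grad (u \<circ> proj_perp e) has_derivative A) (at x)"
    "\<And>h. A h \<bullet> e = 0" "\<And>h. A (proj_perp e h) = A h"
proof -
  let ?X = "grad (u \<circ> proj_perp e)"
  have x: "proj_perp e x = x" using assms(2) by (rule proj_perp_idem)
  obtain A where A: "(?X has_derivative A) (at x)"
    using grad_comp_proj_perp_differentiable[of x] assms x unfolding differentiable_def by auto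
  have X: "?X y \<bullet> e = 0" "?X (proj_perp e y) = ?X y" if "y \<in> proj_perp e -` U" for y
    using that e by (auto simp: grad_comp_proj_perp proj_perp_inner proj_perp_idem)
  have xV: "x \<in> proj_perp e -` U" using assms x by simp
  have "((\<lambda>y. ?X y \<bullet> e) has_derivative (\<lambda>h. A h \<bullet> e)) (at x)"
    by (intro has_derivative_inner_left A)
  then have "((\<lambda>y. 0) has_derivative (\<lambda>h. A h \<bullet> e)) (at x)"
    by (rule has_derivative_transform_within_open[OF _ open_vimage_proj_perp xV]) (simp add: X)
  then have 1: "A h \<bullet> e = 0" for h
    using has_derivative_unique[OF _ has_derivative_const[of 0 "at x"]] by (metis)
  have "((\<lambda>y. ?X (proj_perp e y)) has_derivative (\<lambda>h. A (proj_perp e h))) (at x)"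
    by (rule has_derivative_compose[OF bounded_linear.has_derivative[OF bounded_linear_proj_perp
        has_derivative_ident]]) (simp only: x A)
  then have "(?X has_derivative (\<lambda>h. A (proj_perp e h))) (at x)"
    by (rule has_derivative_transform_within_open[OF _ open_vimage_proj_perp xV]) (simp add: X)
  then have 2: "A (proj_perp e h) = A h" for h
    using has_derivative_unique[OF _ A] by metis
  show ?thesis by (rule that[OF A 1 2])
qed

end

section \<open>Mean curvature operator and traces over the tangent space\<close>

text \<open>Product rule: the derivative of \<open>1 / W\<close> in direction \<open>h\<close> is
  \<open>- (A h \<bullet> X x) / W ^ 3\<close>, and summing its contribution over the basis
  reassembles \<open>A (X x) \<bullet> X x\<close>.\<close>

lemma div_field_normalized:
  fixes X :: "'a::euclidean_space \<Rightarrow> 'a"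
  assumes A: "(X has_derivative A) (at x)"
  defines "W \<equiv> sqrt (1 + (norm (X x))\<^sup>2)"
  shows "div_field (\<lambda>y. X y /\<^sub>R sqrt (1 + (norm (X y))\<^sup>2)) x =
    (\<Sum>b\<in>Basis. A b \<bullet> b) / W - (A (X x) \<bullet> X x) / W ^ 3"
proof -
  interpret A: bounded_linear A using A by (rule has_derivative_bounded_linear)
  have gt: "1 + X y \<bullet> X y > 0" for y by (simp add: add_pos_nonneg)
  have "((\<lambda>y. inverse (sqrt (1 + X y \<bullet> X y))) has_derivative
      (\<lambda>h. - (A h \<bullet> X x) / W ^ 3)) (at x)"
    using gt[of x]
    by (auto intro!: derivative_eq_intros A simp: W_def power2_norm_eq_inner divide_simps
      power3_eq_cube inner_commute fun_eq_iff)
  then have "((\<lambda>y. X y /\<^sub>R sqrt (1 + X y \<bullet> X y)) has_derivative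
      (\<lambda>h. A h /\<^sub>R W + (- (A h \<bullet> X x) / W ^ 3) *\<^sub>R X x)) (at x)"
    by (rule has_derivative_eq_rhs[OF has_derivative_scaleR[OF _ A]])
      (simp add: W_def power2_norm_eq_inner fun_eq_iff)
  then have "div_field (\<lambda>y. X y /\<^sub>R sqrt (1 + (norm (X y))\<^sup>2)) x =
      (\<Sum>b\<in>Basis. (A b /\<^sub>R W + (- (A b \<bullet> X x) / W ^ 3) *\<^sub>R X x) \<bullet> b)"
    unfolding div_field_def power2_norm_eq_inner
    by (subst frechet_derivative_at[symmetric]) auto
  also have "\<dots> = (\<Sum>b\<in>Basis. A b \<bullet> b) / W - (\<Sum>b\<in>Basis. (X x \<bullet> b) * (A b \<bullet> X x)) / W ^ 3"
    by (simp add: inner_diff_left sum_subtractf sum_divide_distrib sum_distrib_left divide_inverse mult_ac)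
  also have "(\<Sum>b\<in>Basis. (X x \<bullet> b) * (A b \<bullet> X x)) = A (\<Sum>b\<in>Basis. (X x \<bullet> b) *\<^sub>R b) \<bullet> X x"
    by (simp add: A.sum A.scaleR inner_sum_left)
  finally show ?thesis by (simp add: euclidean_representation)
qed

lemma sum_inner_Basis_sq:
  fixes y :: "'a::euclidean_space"
  shows "(\<Sum>b\<in>Basis. (y \<bullet> b)\<^sup>2) = y \<bullet> y"
  by (simp add: euclidean_inner[of y y] power2_eq_square)

text \<open>With \<open>p\<close> the gradient of a height function, \<open>Q\<close> is the symmetric square root of the inverse of
  the metric \<open>1 + p p\<^sup>T\<close> of the graph on the hyperplane orthogonal to \<open>e\<close>, so the images of the vectors
  \<open>Q b\<close> under the graph map form a Parseval frame of the tangent space.\<close>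
lemma sum_inner_tangent_frame:
  fixes e p :: "'a::euclidean_space"
  assumes e: "norm e = 1" and p: "p \<bullet> e = 0"
    and W_def: "W = sqrt (1 + p \<bullet> p)"
    and Q_def: "\<And>h. Q h = h - (h \<bullet> e) *\<^sub>R e - ((h \<bullet> p) / (W * (W + 1))) *\<^sub>R p"
  shows "Q h \<bullet> e = 0"
    and "(\<Sum>b\<in>Basis. (c \<bullet> (Q b + (p \<bullet> Q b) *\<^sub>R e))\<^sup>2) = c \<bullet> c - (c \<bullet> (e - p))\<^sup>2 / W\<^sup>2"
    and "\<lbrakk>linear A; \<And>h. A h \<bullet> e = 0; A e = 0\<rbrakk> \<Longrightarrow>
      (\<Sum>b\<in>Basis. A (Q b) \<bullet> Q b) = (\<Sum>b\<in>Basis. A b \<bullet> b) - (A p \<bullet> p) / W\<^sup>2"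
proof -
  have ee: "e \<bullet> e = 1" using e by (simp add: norm_eq_sqrt_inner)
  have ep: "p \<bullet> e = 0" "e \<bullet> p = 0" using p by (simp_all add: inner_commute)
  show "Q h \<bullet> e = 0" by (simp add: Q_def inner_diff_left ee p)
  have gt: "1 + p \<bullet> p > 0" by (simp add: add_pos_nonneg)
  then have W: "W > 0" "W\<^sup>2 = 1 + p \<bullet> p" by (auto simp: W_def)
  define k where "k = 1 / (W * (W + 1))"
  have pp: "p \<bullet> p = W\<^sup>2 - 1" using W by simp
  \<comment> \<open>On the hyperplane \<open>Q\<close> is \<open>1 - k p p^T\<close>, with square
    \<open>1 - (2 k - k\<^sup>2 (p \<bullet> p)) p p^T\<close>. The identity turns this into
    \<open>1 - p p^T / W\<^sup>2\<close>, the inverse of \<open>1 + p p^T\<close>.\<close>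
  have k: "2 * k - k\<^sup>2 * (p \<bullet> p) = 1 / W\<^sup>2"
  proof -
    have "k * (p \<bullet> p) = (W - 1) / W"
    proof -
      have "W\<^sup>2 - 1 = (W + 1) * (W - 1)" by (simp add: power2_eq_square algebra_simps)
      moreover have "W + 1 \<noteq> 0" using W(1) by simp
      ultimately show ?thesis unfolding pp k_def by simp
    qed
    then have "2 * k - k\<^sup>2 * (p \<bullet> p) = k * (2 - (W - 1) / W)"
      by (simp add: power2_eq_square algebra_simps)
    also have "2 - (W - 1) / W = (W + 1) / W"
      using W(1) by (simp add: field_simps)
    also have "k * ((W + 1) / W) = 1 / W\<^sup>2"
    proof -
      have "W + 1 \<noteq> 0" using W(1) by simp
      then show ?thesis by (simp add: k_def power2_eq_square)
    qed
    finally show ?thesis .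
  qed
  have Q: "Q h = h - (h \<bullet> e) *\<^sub>R e - (k * (h \<bullet> p)) *\<^sub>R p" for h
    by (simp add: Q_def k_def)
  \<comment> \<open>\<open>y\<close> is the adjoint of the tangent map
    \<open>\<xi> + (p \<bullet> \<xi>) e\<close> applied to \<open>c\<close>; as \<open>Q\<close> is
    symmetric, the sum of squares becomes the squared length of \<open>Q y\<close>.\<close>
  define y where "y = c + (c \<bullet> e) *\<^sub>R p"
  have sym: "y \<bullet> Q b = Q y \<bullet> b" for b y
    by (simp add: Q inner_diff_left inner_diff_right inner_commute[of b e] inner_commute[of b p])
  have "c \<bullet> (Q b + (p \<bullet> Q b) *\<^sub>R e) = Q y \<bullet> b" for b
    unfolding sym[symmetric] by (simp add: y_def inner_add_left inner_add_right)
  then have "(\<Sum>b\<in>Basis. (c \<bullet> (Q b + (p \<bullet> Q b) *\<^sub>R e))\<^sup>2) = Q y \<bullet> Q y"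
    by (simp add: sum_inner_Basis_sq)
  also have "\<dots> = y \<bullet> y - (y \<bullet> e)\<^sup>2 - (2 * k - k\<^sup>2 * (p \<bullet> p)) * (y \<bullet> p)\<^sup>2"
    by (simp add: Q inner_diff_left inner_diff_right inner_commute[of e y] inner_commute[of p y] ee ep
        power2_eq_square algebra_simps)
  \<comment> \<open>The vector \<open>(e - p) / W\<close> is the unit normal of the graph, so the
    right side is the squared length of the tangential part of \<open>c\<close>.\<close>
  also have "\<dots> = c \<bullet> c - (c \<bullet> (e - p))\<^sup>2 / W\<^sup>2"
  proof -
    have y: "y \<bullet> y = c \<bullet> c + 2 * (c \<bullet> e) * (c \<bullet> p) + (c \<bullet> e)\<^sup>2 * (W\<^sup>2 - 1)"
      "y \<bullet> e = c \<bullet> e" "y \<bullet> p = c \<bullet> p + (c \<bullet> e) * (W\<^sup>2 - 1)"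
      by (auto simp: y_def inner_add_left inner_add_right inner_commute[of p c] p pp[symmetric]
          power2_eq_square[of "c \<bullet> e"] algebra_simps)
    have "(\<beta> + \<alpha> * (w - 1))\<^sup>2 / w = (\<alpha> - \<beta>)\<^sup>2 / w + 2 * \<alpha> * (\<beta> - \<alpha>) + \<alpha>\<^sup>2 * w" if "w > 0" for \<alpha> \<beta> w :: real
    proof -
      have "(\<beta> + \<alpha> * (w - 1))\<^sup>2 = (\<alpha> - \<beta>)\<^sup>2 + (2 * \<alpha> * (\<beta> - \<alpha>) + \<alpha>\<^sup>2 * w) * w"
        by (simp add: power2_eq_square algebra_simps)
      then show ?thesis using that by (simp add: add_divide_distrib)
    qed
    from this[of "W\<^sup>2" "c \<bullet> p" "c \<bullet> e"] show ?thesis unfolding k y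
      using W(1) by (simp add: inner_diff_right power2_eq_square[of "c \<bullet> e"] algebra_simps)
  qed
  finally show "(\<Sum>b\<in>Basis. (c \<bullet> (Q b + (p \<bullet> Q b) *\<^sub>R e))\<^sup>2) = c \<bullet> c - (c \<bullet> (e - p))\<^sup>2 / W\<^sup>2" .
  assume A: "linear A" "\<And>h. A h \<bullet> e = 0" "A e = 0"
  interpret A: linear A by fact
  have 1: "(\<Sum>b\<in>Basis. (p \<bullet> b) * (A b \<bullet> p)) = A p \<bullet> p"
  proof -
    have "(\<Sum>b\<in>Basis. (p \<bullet> b) * (A b \<bullet> p)) = A (\<Sum>b\<in>Basis. (p \<bullet> b) *\<^sub>R b) \<bullet> p"
      by (simp add: A.sum A.scale inner_sum_left)
    then show ?thesis by (simp add: euclidean_representation)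
  qed
  have 2: "(\<Sum>b\<in>Basis. (A p \<bullet> b) * (p \<bullet> b)) = A p \<bullet> p" by (rule euclidean_inner[symmetric])
  have 3: "(\<Sum>b\<in>Basis. (p \<bullet> b)\<^sup>2) = p \<bullet> p" by (rule sum_inner_Basis_sq)
  have "A (Q b) \<bullet> Q b = A b \<bullet> b - k * ((p \<bullet> b) * (A b \<bullet> p)) - k * ((A p \<bullet> b) * (p \<bullet> b))
      + k\<^sup>2 * (A p \<bullet> p) * (p \<bullet> b)\<^sup>2" for b
  proof -
    have AQ: "A (Q b) = A b - (k * (p \<bullet> b)) *\<^sub>R A p"
      by (simp add: Q A.diff A.scale A(3) inner_commute[of b p])
    then have "A (Q b) \<bullet> e = 0" by (simp add: A(2) inner_diff_left)
    then have AQQ: "A (Q b) \<bullet> Q b = A (Q b) \<bullet> b - k * (p \<bullet> b) * (A (Q b) \<bullet> p)"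
      by (simp add: Q[of b] inner_diff_right inner_commute[of b p])
    show ?thesis
      unfolding AQQ unfolding AQ by (simp add: inner_diff_left power2_eq_square algebra_simps)
  qed
  note AQQ = this
  have "(\<Sum>b\<in>Basis. A (Q b) \<bullet> Q b) = (\<Sum>b\<in>Basis. A b \<bullet> b)
      - k * (A p \<bullet> p) - k * (A p \<bullet> p) + k\<^sup>2 * (A p \<bullet> p) * (p \<bullet> p)"
    unfolding AQQ sum.distrib sum_subtractf unfolding sum_distrib_left[symmetric] 1 2 3 ..
  also have "\<dots> = (\<Sum>b\<in>Basis. A b \<bullet> b) - (2 * k - k\<^sup>2 * (p \<bullet> p)) * (A p \<bullet> p)"
    by (simp add: algebra_simps)
  finally show "(\<Sum>b\<in>Basis. A (Q b) \<bullet> Q b) = (\<Sum>b\<in>Basis. A b \<bullet> b) - (A p \<bullet> p) / W\<^sup>2"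
    by (simp add: k)
qed

text \<open>\<open>nonpos\<close> is the second derivative test for the barrier and
  \<open>normal\<close> says that its gradient is a multiple of the graph normal. Summing
  \<open>nonpos\<close> over the tangent frame replaces the Hessian term by 1, thanks to
  \<open>eq\<close>, and the other two terms by the tangential parts of \<open>a\<close> and
  \<open>b\<close>.\<close>

lemma grim_reaper_trace_contradiction:
  fixes v a b e p :: "'a::euclidean_space" and T z \<epsilon> \<mu> :: real
  assumes norms: "norm v = 1" "norm a = 1" "norm b = 1" "norm e = 1"
    and orth: "a \<bullet> v = 0" "b \<bullet> v = 0" "b \<bullet> a = 0" "p \<bullet> e = 0"
    and A: "linear A" "\<And>h. A h \<bullet> e = 0" "A e = 0"
    and normal: "v - T *\<^sub>R a + (2 * \<epsilon> * z) *\<^sub>R b = \<mu> *\<^sub>R (e - p)"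
    and eq: "\<mu> * ((\<Sum>b\<in>Basis. A b \<bullet> b) - (A p \<bullet> p) / (1 + p \<bullet> p)) = 1"
    and nonpos: "\<And>\<xi>. \<xi> \<bullet> e = 0 \<Longrightarrow>
      - (1 + T\<^sup>2) * (a \<bullet> (\<xi> + (p \<bullet> \<xi>) *\<^sub>R e))\<^sup>2 + 2 * \<epsilon> * (b \<bullet> (\<xi> + (p \<bullet> \<xi>) *\<^sub>R e))\<^sup>2
        + \<mu> * (A \<xi> \<bullet> \<xi>) \<le> 0"
    and \<epsilon>: "\<epsilon> > 0" "2 * \<epsilon> * z\<^sup>2 < 1"
  shows False
proof -
  have u: "v \<bullet> v = 1" "a \<bullet> a = 1" "b \<bullet> b = 1" "e \<bullet> e = 1"
    using norms by (simp_all add: norm_eq_sqrt_inner)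
  have o: "v \<bullet> a = 0" "v \<bullet> b = 0" "a \<bullet> b = 0" "e \<bullet> p = 0"
    using orth by (simp_all add: inner_commute)
  define s where "s = 1 + T\<^sup>2"
  define W where "W = sqrt (1 + p \<bullet> p)"
  define Q where "Q h = h - (h \<bullet> e) *\<^sub>R e - ((h \<bullet> p) / (W * (W + 1))) *\<^sub>R p" for h
  note frame = sum_inner_tangent_frame[OF norms(4) orth(4) W_def, of Q, OF Q_def]
  have W2: "W\<^sup>2 = 1 + p \<bullet> p" by (simp add: W_def add_pos_nonneg)
  have "(\<Sum>i\<in>Basis. - s * (a \<bullet> (Q i + (p \<bullet> Q i) *\<^sub>R e))\<^sup>2
      + 2 * \<epsilon> * (b \<bullet> (Q i + (p \<bullet> Q i) *\<^sub>R e))\<^sup>2 + \<mu> * (A (Q i) \<bullet> Q i)) \<le> 0"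
    by (rule sum_nonpos) (use nonpos[OF frame(1)] in \<open>simp add: s_def\<close>)
  then have le: "- s * (1 - (a \<bullet> (e - p))\<^sup>2 / W\<^sup>2) + 2 * \<epsilon> * (1 - (b \<bullet> (e - p))\<^sup>2 / W\<^sup>2) + 1 \<le> 0"
    using frame(3)[OF A] eq
    by (simp only: sum.distrib sum_distrib_left[symmetric] frame(2) u W2)
  let ?n = "v - T *\<^sub>R a + (2 * \<epsilon> * z) *\<^sub>R b"
  \<comment> \<open>The squared length of the barrier gradient is computed from its components and
    again as \<open>\<mu>\<^sup>2 * W\<^sup>2\<close>. Comparing both expresses the normal parts of
    \<open>a\<close> and \<open>b\<close> as quotients by \<open>r\<close>.\<close>
  define r where "r = ?n \<bullet> ?n"
  have r: "r = s + 4 * \<epsilon>\<^sup>2 * z\<^sup>2"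
    by (simp add: r_def s_def inner_add_left inner_add_right inner_diff_left inner_diff_right u o orth
       power2_eq_square algebra_simps)
  have rpos: "r > 0" unfolding r s_def by (intro add_pos_nonneg) auto
  have rW: "r = \<mu>\<^sup>2 * W\<^sup>2" unfolding r_def normal W2
    by (simp add: inner_diff_left inner_diff_right u o orth power2_eq_square algebra_simps)
  have "\<mu> * (a \<bullet> (e - p)) = a \<bullet> ?n" "\<mu> * (b \<bullet> (e - p)) = b \<bullet> ?n"
    unfolding normal by simp_all
  then have "\<mu> * (a \<bullet> (e - p)) = - T" and "\<mu> * (b \<bullet> (e - p)) = 2 * \<epsilon> * z"
    by (simp_all add: inner_add_right inner_diff_right u o orth)
  then have "(\<mu> * (a \<bullet> (e - p)))\<^sup>2 = (- T)\<^sup>2" "(\<mu> * (b \<bullet> (e - p)))\<^sup>2 = (2 * \<epsilon> * z)\<^sup>2"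
    by (simp_all only:)
  then have *: "\<mu>\<^sup>2 * (a \<bullet> (e - p))\<^sup>2 = T\<^sup>2" "\<mu>\<^sup>2 * (b \<bullet> (e - p))\<^sup>2 = 4 * \<epsilon>\<^sup>2 * z\<^sup>2"
    by (simp_all add: power_mult_distrib)
  have nz: "\<mu>\<^sup>2 \<noteq> 0" "W\<^sup>2 \<noteq> 0" using rpos rW by auto
  have quot: "(a \<bullet> (e - p))\<^sup>2 / W\<^sup>2 = T\<^sup>2 / r" "(b \<bullet> (e - p))\<^sup>2 / W\<^sup>2 = 4 * \<epsilon>\<^sup>2 * z\<^sup>2 / r"
    unfolding rW *[symmetric] using nz by simp_all
  have "r * (- s * (1 - T\<^sup>2 / r) + 2 * \<epsilon> * (1 - 4 * \<epsilon>\<^sup>2 * z\<^sup>2 / r) + 1) \<le> 0"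
    using mult_nonneg_nonpos[OF less_imp_le[OF rpos] le[unfolded quot]] .
  moreover have "r * (- s * (1 - T\<^sup>2 / r) + 2 * \<epsilon> * (1 - 4 * \<epsilon>\<^sup>2 * z\<^sup>2 / r) + 1) =
      - s * (r - T\<^sup>2) + 2 * \<epsilon> * (r - 4 * \<epsilon>\<^sup>2 * z\<^sup>2) + r"
  proof -
    have "r * (1 - x / r) = r - x" for x using rpos by (simp add: right_diff_distrib)
    then have "- s * (r * (1 - T\<^sup>2 / r)) + 2 * \<epsilon> * (r * (1 - 4 * \<epsilon>\<^sup>2 * z\<^sup>2 / r)) + r =
        - s * (r - T\<^sup>2) + 2 * \<epsilon> * (r - 4 * \<epsilon>\<^sup>2 * z\<^sup>2) + r" by simp
    then show ?thesis by (simp only: distrib_left mult.left_commute[of r "- s"] mult.left_commute[of r "2 * \<epsilon>"] mult_1_right)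
  qed
  ultimately have "- s * (r - T\<^sup>2) + 2 * \<epsilon> * (r - 4 * \<epsilon>\<^sup>2 * z\<^sup>2) + r \<le> 0"
    by simp
  \<comment> \<open>For \<open>\<epsilon> = 0\<close> the left side vanishes, because the grim
    reaper cylinder is itself a translator. The bending leaves a positive term as long as
    \<open>2 * \<epsilon> * z\<^sup>2 < 1\<close>.\<close>
  then have "2 * \<epsilon> * s * (1 - 2 * \<epsilon> * z\<^sup>2) + 4 * \<epsilon>\<^sup>2 * z\<^sup>2 \<le> 0"
    unfolding r s_def by (simp add: power2_eq_square algebra_simps)
  moreover have "2 * \<epsilon> * s * (1 - 2 * \<epsilon> * z\<^sup>2) > 0"
    using \<epsilon> by (simp add: s_def add_pos_nonneg)
  moreover have "4 * \<epsilon>\<^sup>2 * z\<^sup>2 \<ge> 0" by simp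
  ultimately show False by linarith
qed

section \<open>Convex bodies inside a hyperplane\<close>

text \<open>The body has affine dimension at least 2, which makes its relative frontier connected.
  The frontier is nonempty because a bounded affine set has at most one point.\<close>

lemma strictly_convex_hypersurface_facts:
  fixes v :: "'a::euclidean_space"
  assumes dim: "DIM('a) \<ge> 3" and v: "v \<noteq> 0"
    and K: "strictly_convex_hypersurface_of {x. x \<bullet> v = c} K \<Gamma>"
  shows "compact K" "convex K" "\<Gamma> \<subseteq> K" "\<Gamma> \<noteq> {}" "connected \<Gamma>" "K \<subseteq> {x. x \<bullet> v = c}"
    "affine hull K = {x. x \<bullet> v = c}" "\<Gamma> = rel_frontier K"
proof -
  show K': "compact K" "convex K" "affine hull K = {x. x \<bullet> v = c}" "\<Gamma> = rel_frontier K"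
    using K unfolding strictly_convex_hypersurface_of_def by simp_all
  show "\<Gamma> \<subseteq> K"
    unfolding K'(4) rel_frontier_def closure_closed[OF compact_imp_closed[OF K'(1)]] by blast
  show "K \<subseteq> {x. x \<bullet> v = c}" using hull_subset[of K affine] unfolding K'(3) .
  have ad: "aff_dim K = int DIM('a) - 1"
    using aff_dim_hyperplane[OF v, of c] aff_dim_affine_hull[of K]
    unfolding K'(3) by (simp add: inner_commute[of v])
  show "connected \<Gamma>"
    unfolding K'(4) using ad dim
    by (intro connected_sphere_gen K'(2) compact_imp_bounded[OF K'(1)]) linarith
  have "K \<noteq> {}" "K \<noteq> {z}" for z
    using ad dim by auto
  then have "\<not> affine K"
    using affine_bounded_eq_trivial[of K] compact_imp_bounded[OF K'(1)] by blast
  then show "\<Gamma> \<noteq> {}" by (simp add: K'(4) rel_frontier_eq_empty)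
qed

text \<open>Away from the relative frontier, meeting \<open>K\<close> is the same as meeting its
  relative interior, so \<open>S \<inter> K\<close> is both closed and open in
  \<open>S\<close>.\<close>

lemma connected_disjoint_rel_frontier:
  fixes S K :: "'a::euclidean_space set"
  assumes "connected S" "S \<subseteq> affine hull K" "closed K" "S \<inter> rel_frontier K = {}"
  shows "S \<subseteq> K \<or> S \<inter> K = {}"
proof -
  have eq: "S \<inter> K = S \<inter> rel_interior K"
    using assms(3,4) rel_interior_subset[of K] by (auto simp: rel_frontier_def)
  have "closedin (top_of_set S) (S \<inter> K)"
    using assms(3) by (rule closedin_closed_Int)
  moreover have "openin (top_of_set S) (S \<inter> K)"
    unfolding eq
  proof (rule openin_subtopology_Int_subset[OF _ assms(2)])
    have "affine hull K \<inter> rel_interior K = rel_interior K"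
      using rel_interior_subset[of K] hull_subset[of K affine] by blast
    then show "openin (top_of_set (affine hull K)) (affine hull K \<inter> rel_interior K)"
      by (simp add: openin_rel_interior)
  qed
  ultimately have "S \<inter> K = {} \<or> S \<inter> K = S"
    using assms(1) unfolding connected_clopen by blast
  then show ?thesis by blast
qed

section \<open>Curves in the charts of \<open>M\<close>\<close>

text \<open>Turns membership in \<open>M\<close> near \<open>p\<close> into an equation between
  ambient functions, which can be differentiated along any curve running in
  \<open>M\<close>.\<close>

lemma height_eq_on_interior_chart:
  assumes "interior_chart M p e r U u D" "q \<in> M" "q \<in> ball p r"
  shows "proj_perp e q \<in> U" "q \<bullet> e = u (proj_perp e q)"
proof -
  obtain x where x: "x \<in> U" "x \<bullet> e = 0" "q = x + u x *\<^sub>R e" and e: "norm e = 1"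
  proof -
    have "q \<in> graph_pt e u ` D" "D = U \<inter> hyperplane0 e" "norm e = 1"
      using assms by (auto simp: interior_chart_def graph_chart_def)
    then show ?thesis using that by (auto simp: graph_pt_def hyperplane0_def)
  qed
  have "e \<bullet> e = 1" using e by (simp add: norm_eq_sqrt_inner)
  then have "q \<bullet> e = u x" "proj_perp e q = x"
    using x by (auto simp: proj_perp_def inner_add_left)
  then show "proj_perp e q \<in> U" "q \<bullet> e = u (proj_perp e q)" using x by auto
qed

lemma graph_curve_has_vector_derivative:
  assumes "norm e = 1" "open U" "smooth_on U u" "x \<bullet> e = 0" "\<xi> \<bullet> e = 0" "x + t *\<^sub>R \<xi> \<in> U"
  shows "((\<lambda>t. graph_pt e (u \<circ> proj_perp e) (x + t *\<^sub>R \<xi>)) has_vector_derivative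
    \<xi> + (grad (u \<circ> proj_perp e) (x + t *\<^sub>R \<xi>) \<bullet> \<xi>) *\<^sub>R e) (at t)"
proof -
  let ?w = "u \<circ> proj_perp e"
  have perp: "(x + t *\<^sub>R \<xi>) \<bullet> e = 0" using assms by (simp add: inner_add_left)
  have line: "((\<lambda>t. x + t *\<^sub>R \<xi>) has_derivative (\<lambda>h. h *\<^sub>R \<xi>)) (at t)"
    by (auto intro!: derivative_eq_intros)
  have "(?w has_derivative (\<lambda>h. grad ?w (x + t *\<^sub>R \<xi>) \<bullet> h)) (at (x + t *\<^sub>R \<xi>))"
    by (rule has_derivative_grad, rule differentiableI)
      (rule has_derivative_comp_proj_perp[OF assms(1-3)], use assms(6) perp in \<open>simp add: proj_perp_idem\<close>)
  from has_derivative_compose[OF line this]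
  have w: "((\<lambda>t. ?w (x + t *\<^sub>R \<xi>)) has_derivative (\<lambda>h. h * (grad ?w (x + t *\<^sub>R \<xi>) \<bullet> \<xi>))) (at t)"
    by simp
  show ?thesis
    unfolding graph_pt_def has_vector_derivative_def
    by (rule has_derivative_eq_rhs[OF has_derivative_add[OF line has_derivative_scaleR_left[OF w]]])
      (simp add: fun_eq_iff scaleR_add_right)
qed

lemma eventually_line_in_open:
  fixes x \<xi> :: "'a::real_normed_vector"
  assumes "open U" "x \<in> U"
  shows "\<forall>\<^sub>F t in nhds (0::real). x + t *\<^sub>R \<xi> \<in> U"
proof -
  have "((\<lambda>t::real. x + t *\<^sub>R \<xi>) \<longlongrightarrow> x + 0 *\<^sub>R \<xi>) (nhds 0)"
    by (intro tendsto_intros filterlim_ident)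
  then show ?thesis using assms by (auto simp: tendsto_def)
qed

text \<open>A maximum of \<open>G\<close> on \<open>M\<close> at an interior point is critical even along curves that stay in \<open>M\<close>
  for positive times only, because their velocities are tangent to the graph of the chart.\<close>
lemma critical_along_right_curve:
  fixes M :: "'a::euclidean_space set"
  assumes chart: "interior_chart M p e r U u D"
    and G: "(G has_derivative (\<lambda>h. N \<bullet> h)) (at p)"
    and S: "open S" "p \<in> S" "\<And>q. q \<in> M \<inter> S \<Longrightarrow> G q \<le> (G p :: real)"
    and \<gamma>: "(\<gamma> has_vector_derivative \<tau>) (at 0)" "\<gamma> 0 = p" "\<forall>\<^sub>F t in at_right 0. \<gamma> t \<in> M"
  shows "N \<bullet> \<tau> = 0"
proof -
  let ?w = "u \<circ> proj_perp e"
  have e: "norm e = 1" and r: "r > 0" and U: "open U" and u: "smooth_on U u" and D: "D = U \<inter> hyperplane0 e"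
    and pM: "p \<in> M" and M: "M \<inter> ball p r = graph_pt e u ` D \<inter> ball p r"
    using chart by (auto simp: interior_chart_def graph_chart_def)
  have ee: "e \<bullet> e = 1" using e by (simp add: norm_eq_sqrt_inner)
  define x where "x = proj_perp e p"
  have xU: "x \<in> U" and pe: "p \<bullet> e = u x"
    using height_eq_on_interior_chart[OF chart pM] r by (auto simp: x_def)
  have xe: "x \<bullet> e = 0" unfolding x_def using e by (rule proj_perp_inner)
  have px: "p = graph_pt e u x"
    unfolding graph_pt_def pe[symmetric] by (simp add: x_def proj_perp_def)
  have xp: "proj_perp e x = x" using xe by (rule proj_perp_idem)
  define g where "g = grad ?w x"
  have ge: "g \<bullet> e = 0"
    unfolding g_def using grad_comp_proj_perp[OF e U u, of x] xU xp e by (simp add: proj_perp_inner)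
  \<comment> \<open>In the interior chart the graph curves through \<open>p\<close> lie in
    \<open>M\<close> for both signs of \<open>t\<close>, so the ordinary first derivative test
    applies to them.\<close>
  have tangent: "N \<bullet> (\<xi> + (g \<bullet> \<xi>) *\<^sub>R e) = 0" if \<xi>: "\<xi> \<bullet> e = 0" for \<xi>
  proof -
    define c where "c = (\<lambda>t. graph_pt e ?w (x + t *\<^sub>R \<xi>))"
    have c: "(c has_vector_derivative \<xi> + (g \<bullet> \<xi>) *\<^sub>R e) (at 0)"
      using graph_curve_has_vector_derivative[OF e U u xe \<xi>, of 0] xU by (simp add: c_def g_def)
    have c0: "c 0 = p" using px xp by (simp add: c_def graph_pt_def)
    have deriv: "((\<lambda>t. G (c t)) has_derivative (\<lambda>h. N \<bullet> (h *\<^sub>R (\<xi> + (g \<bullet> \<xi>) *\<^sub>R e)))) (at 0)"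
      using has_derivative_compose[OF c[unfolded has_vector_derivative_def], of G "\<lambda>h. N \<bullet> h"] G c0
      by simp
    have "isCont c 0" using c by (rule has_vector_derivative_continuous)
    then have "\<forall>\<^sub>F t in nhds 0. c t \<in> S \<inter> ball p r"
      using open_Int[OF S(1) open_ball[of p r]] c0 S(1,2) r
      by (auto simp: isCont_def tendsto_def eventually_nhds_conv_at)
    moreover have "\<forall>\<^sub>F t in nhds 0. x + t *\<^sub>R \<xi> \<in> U" using U xU by (rule eventually_line_in_open)
    ultimately have "\<forall>\<^sub>F t in nhds 0. G (c t) \<le> G (c 0)"
    proof eventually_elim
      case (elim t)
      have "x + t *\<^sub>R \<xi> \<in> D"
        using elim xe \<xi> by (simp add: D hyperplane0_def inner_add_left)
      moreover have "c t = graph_pt e u (x + t *\<^sub>R \<xi>)"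
        using xe \<xi> by (simp add: c_def graph_pt_def proj_perp_idem inner_add_left)
      ultimately have "c t \<in> M" using M elim by blast
      then show ?case using S(3) elim c0 by simp
    qed
    then have "\<forall>\<^sub>F t in at 0. G (c t) \<le> G (c 0)"
      by (simp add: eventually_nhds_conv_at)
    then have "(\<lambda>h. N \<bullet> (h *\<^sub>R (\<xi> + (g \<bullet> \<xi>) *\<^sub>R e))) = (\<lambda>h. 0)"
      by (rule has_derivative_local_max[OF deriv])
    from fun_cong[OF this, of 1] show ?thesis by simp
  qed
  have "isCont \<gamma> 0" using \<gamma>(1) by (rule has_vector_derivative_continuous)
  then have "\<forall>\<^sub>F t in at 0. \<gamma> t \<in> ball p r"
    using \<gamma>(2) r open_ball[of p r] by (auto simp: isCont_def tendsto_def simp del: mem_ball)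
  then have "\<forall>\<^sub>F t in at_right 0. \<gamma> t \<in> ball p r"
    by (simp add: eventually_at_split)
  \<comment> \<open>Along the given curve the height equation of the interior chart holds for
    positive times. Its right derivative at 0 shows that the velocity is tangent to the graph, and
    then \<open>tangent\<close> applies to its projection.\<close>
  with \<gamma>(3) have on_graph: "\<forall>\<^sub>F t in at_right 0. \<gamma> t \<bullet> e - ?w (\<gamma> t) = \<gamma> 0 \<bullet> e - ?w (\<gamma> 0)"
    by eventually_elim (use height_eq_on_interior_chart[OF chart] pe \<gamma>(2) in \<open>simp add: x_def\<close>)
  have w: "(?w has_derivative (\<lambda>h. grad ?w p \<bullet> h)) (at p)"
    by (rule has_derivative_grad, rule differentiableI,
        rule has_derivative_comp_proj_perp[OF e U u]) (use xU in \<open>simp add: x_def\<close>)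
  have gp: "grad ?w p = g"
    using grad_comp_proj_perp[OF e U u] xU xp by (simp add: g_def x_def[symmetric])
  have "((\<lambda>t. ?w (\<gamma> t)) has_derivative (\<lambda>h. g \<bullet> (h *\<^sub>R \<tau>))) (at 0)"
    using has_derivative_compose[OF \<gamma>(1)[unfolded has_vector_derivative_def], of ?w "\<lambda>h. g \<bullet> h"] \<gamma>(2) w gp
    by simp
  moreover have "((\<lambda>t. \<gamma> t \<bullet> e) has_derivative (\<lambda>h. (h *\<^sub>R \<tau>) \<bullet> e)) (at 0)"
    using \<gamma>(1) unfolding has_vector_derivative_def by (rule has_derivative_inner_left)
  ultimately have "((\<lambda>t. \<gamma> t \<bullet> e - ?w (\<gamma> t)) has_derivative (\<lambda>h. (h *\<^sub>R \<tau>) \<bullet> e - g \<bullet> (h *\<^sub>R \<tau>))) (at 0)"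
    by (intro has_derivative_diff)
  then have "((\<lambda>t. \<gamma> t \<bullet> e - ?w (\<gamma> t)) has_real_derivative \<tau> \<bullet> e - g \<bullet> \<tau>) (at 0)"
    by (simp add: has_field_derivative_def mult_commute_abs right_diff_distrib[symmetric] del: o_apply)
  from DERIV_eq_0_if_right_const[OF this on_graph] have \<tau>e: "\<tau> \<bullet> e = g \<bullet> \<tau>" by simp
  have "N \<bullet> (proj_perp e \<tau> + (g \<bullet> proj_perp e \<tau>) *\<^sub>R e) = 0"
    using e by (intro tangent proj_perp_inner)
  then show ?thesis using ge by (simp add: proj_perp_def inner_diff_right \<tau>e[symmetric])
qed

text \<open>Gives both kinds of chart one form. In a boundary chart \<open>n\<close> is the gradient
  of the defining function, which vanishes at \<open>x\<close> and so becomes positive along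
  \<open>\<xi>\<close>. In an interior chart every direction stays in \<open>D\<close>, and any
  nonzero \<open>n\<close> orthogonal to \<open>e\<close> will do.\<close>

lemma chart_inward_directions:
  fixes M :: "'a::euclidean_space set"
  assumes dim: "DIM('a) \<ge> 2"
    and chart: "interior_chart M p e r U u D \<or> boundary_chart M p e r U u D"
  obtains x n where "x \<in> D" "p = graph_pt e u x" "n \<noteq> 0" "n \<bullet> e = 0"
    "\<And>\<xi>. \<xi> \<bullet> e = 0 \<Longrightarrow> n \<bullet> \<xi> > 0 \<Longrightarrow> \<forall>\<^sub>F t in at_right 0. x + t *\<^sub>R \<xi> \<in> D"
proof -
  have "graph_chart M p e r U u D"
    using chart by (auto simp: interior_chart_def boundary_chart_def)
  then have e: "norm e = 1" and r: "r > 0" and U: "open U" and pM: "p \<in> M"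
    and M: "M \<inter> ball p r = graph_pt e u ` D \<inter> ball p r"
    by (auto simp: graph_chart_def)
  from chart show thesis
  proof
    assume "interior_chart M p e r U u D"
    then have D: "D = U \<inter> hyperplane0 e" by (simp add: interior_chart_def)
    obtain x where x: "x \<in> D" "p = graph_pt e u x" using M pM r by fastforce
    obtain n where n: "n \<noteq> 0" "orthogonal e n" using orthogonal_to_vector_exists[OF dim] by blast
    show thesis
    proof (rule that[OF x n(1)])
      show "n \<bullet> e = 0" using n(2) by (simp add: orthogonal_def inner_commute)
      fix \<xi> assume \<xi>: "\<xi> \<bullet> e = 0"
      have "\<forall>\<^sub>F t in nhds 0. x + t *\<^sub>R \<xi> \<in> U" using U x(1) by (intro eventually_line_in_open) (auto simp: D)
      then have "\<forall>\<^sub>F t in at_right 0. x + t *\<^sub>R \<xi> \<in> U" by (simp add: eventually_nhds_conv_at eventually_at_split)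
      then show "\<forall>\<^sub>F t in at_right 0. x + t *\<^sub>R \<xi> \<in> D"
        by eventually_elim (use x(1) \<xi> in \<open>auto simp: D hyperplane0_def inner_add_left\<close>)
    qed
  next
    assume "boundary_chart M p e r U u D"
    then obtain \<phi> x where \<phi>: "smooth_on U \<phi>" and D: "D = {x \<in> U \<inter> hyperplane0 e. \<phi> x \<ge> 0}"
      and nz: "\<And>x. x \<in> U \<inter> hyperplane0 e \<Longrightarrow> grad (\<phi> \<circ> proj_perp e) x \<noteq> 0"
      and x: "x \<in> U" "x \<bullet> e = 0" "\<phi> x = 0" "p = graph_pt e u x"
      by (auto simp: boundary_chart_def hyperplane0_def)
    have xp: "proj_perp e x = x" using x(2) by (rule proj_perp_idem)
    define n where "n = grad (\<phi> \<circ> proj_perp e) x"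
    show thesis
    proof (rule that)
      show "x \<in> D" using x by (simp add: D hyperplane0_def)
      show "p = graph_pt e u x" by fact
      show "n \<noteq> 0" using nz x by (simp add: n_def hyperplane0_def)
      show "n \<bullet> e = 0" unfolding n_def using grad_comp_proj_perp[OF e U \<phi>, of x] x xp e
        by (simp add: proj_perp_inner)
      fix \<xi> assume \<xi>: "\<xi> \<bullet> e = 0" "n \<bullet> \<xi> > 0"
      have "((\<phi> \<circ> proj_perp e) has_derivative (\<lambda>h. n \<bullet> h)) (at (x + 0 *\<^sub>R \<xi>))"
        unfolding n_def using xp x by (auto intro!: has_derivative_grad differentiableI
          has_derivative_comp_proj_perp[OF e U \<phi>])
      then have "((\<lambda>t. (\<phi> \<circ> proj_perp e) (x + t *\<^sub>R \<xi>)) has_derivative (\<lambda>h. n \<bullet> (h *\<^sub>R \<xi>))) (at 0)"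
        by (rule has_derivative_compose[rotated]) (auto intro!: derivative_eq_intros)
      then have "((\<lambda>t. (\<phi> \<circ> proj_perp e) (x + t *\<^sub>R \<xi>)) has_real_derivative n \<bullet> \<xi>) (at 0)"
        by (simp add: has_field_derivative_def mult_commute_abs)
      from DERIV_pos_inc_right[OF this \<xi>(2)]
      have "\<forall>\<^sub>F t in at_right 0. \<phi> (x + t *\<^sub>R \<xi>) > 0"
        using xp x \<xi> by (auto simp: eventually_at_right_field proj_perp_idem inner_add_left)
      moreover have "\<forall>\<^sub>F t in nhds 0. x + t *\<^sub>R \<xi> \<in> U" using U x(1) by (rule eventually_line_in_open)
      then have "\<forall>\<^sub>F t in at_right 0. x + t *\<^sub>R \<xi> \<in> U" by (simp add: eventually_nhds_conv_at eventually_at_split)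
      ultimately show "\<forall>\<^sub>F t in at_right 0. x + t *\<^sub>R \<xi> \<in> D"
        by eventually_elim (use x(2) \<xi> in \<open>auto simp: D hyperplane0_def inner_add_left\<close>)
    qed
  qed
qed

text \<open>Let \<open>s\<close> tend to 0 from the right. This extends the second order condition
  from inward directions to those tangent to the boundary.\<close>

lemma quadratic_perturbation_nonpos:
  fixes b0 b1 b2 :: real
  assumes "\<And>s. s > 0 \<Longrightarrow> b0 + s * b1 + s\<^sup>2 * b2 \<le> 0"
  shows "b0 \<le> 0"
proof -
  have "((\<lambda>s. b0 + s * b1 + s\<^sup>2 * b2) \<longlongrightarrow> b0 + 0 * b1 + 0\<^sup>2 * b2) (at_right 0)"
    by (intro tendsto_intros)
  moreover have "\<forall>\<^sub>F s in at_right 0. b0 + s * b1 + s\<^sup>2 * b2 \<le> 0"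
    using assms by (auto simp: eventually_at_right_field intro: exI[of _ 1])
  ultimately have "b0 + 0 * b1 + 0\<^sup>2 * b2 \<le> 0"
    by (rule tendsto_upperbound) simp
  then show ?thesis by simp
qed

section \<open>The bent grim reaper barrier and its derivatives\<close>

text \<open>The level sets are grim reaper cylinders in the slab \<open>\<bar>q \<bullet> a - y0\<bar> < pi / 2\<close>, bent downwards in
  direction \<open>b\<close>; the bending makes them strict barriers for translators.\<close>
definition grim_barrier :: "'a::euclidean_space \<Rightarrow> 'a \<Rightarrow> real \<Rightarrow> 'a \<Rightarrow> real \<Rightarrow> 'a \<Rightarrow> real" where
  "grim_barrier v a y0 b \<epsilon> q = q \<bullet> v + ln (cos (q \<bullet> a - y0)) + \<epsilon> * (q \<bullet> b)\<^sup>2"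

definition grim_grad :: "'a::euclidean_space \<Rightarrow> 'a \<Rightarrow> real \<Rightarrow> 'a \<Rightarrow> real \<Rightarrow> 'a \<Rightarrow> 'a" where
  "grim_grad v a y0 b \<epsilon> q = v - tan (q \<bullet> a - y0) *\<^sub>R a + (2 * \<epsilon> * (q \<bullet> b)) *\<^sub>R b"

lemma cos_pos_slab: "\<bar>y\<bar> < pi / 2 \<Longrightarrow> cos y > 0"
  by (rule cos_gt_zero_pi) auto

lemma has_derivative_grim_barrier:
  assumes "\<bar>q \<bullet> a - y0\<bar> < pi / 2"
  shows "(grim_barrier v a y0 b \<epsilon> has_derivative (\<lambda>h. grim_grad v a y0 b \<epsilon> q \<bullet> h)) (at q)"
proof -
  have c: "cos (q \<bullet> a - y0) > 0" using assms by (rule cos_pos_slab)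
  have y: "((\<lambda>q. q \<bullet> a - y0) has_derivative (\<lambda>h. h \<bullet> a)) (at q)"
    by (auto intro!: derivative_eq_intros)
  have ln: "((\<lambda>y. ln (cos y)) has_real_derivative - tan (q \<bullet> a - y0)) (at (q \<bullet> a - y0))"
    using c by (auto intro!: derivative_eq_intros simp: tan_def divide_inverse)
  note l = DERIV_compose_FDERIV[OF ln y]
  have b: "((\<lambda>q. \<epsilon> * (q \<bullet> b)\<^sup>2) has_derivative (\<lambda>h. 2 * \<epsilon> * (q \<bullet> b) * (h \<bullet> b))) (at q)"
    by (auto intro!: derivative_eq_intros)
  have v: "((\<lambda>q. q \<bullet> v) has_derivative (\<lambda>h. h \<bullet> v)) (at q)"
    by (auto intro!: derivative_eq_intros)
  show ?thesis unfolding grim_barrier_def[abs_def] grim_grad_def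
    by (rule has_derivative_eq_rhs[OF has_derivative_add[OF has_derivative_add[OF v l] b]])
      (simp add: fun_eq_iff inner_add_left inner_diff_left inner_commute[of _ v] inner_commute[of _ a]
          inner_commute[of _ b] mult.commute)
qed

text \<open>With the derivative of \<open>tan\<close> written as \<open>1 + tan\<^sup>2\<close>,
  gradient and Hessian depend on the slab coordinate through one number \<open>T\<close>, which the
  trace computation treats as arbitrary.\<close>

lemma grim_grad_has_derivative:
  assumes "\<bar>q \<bullet> a - y0\<bar> < pi / 2"
  shows "(grim_grad v a y0 b \<epsilon> has_derivative (\<lambda>h.
    - ((1 + (tan (q \<bullet> a - y0))\<^sup>2) * (h \<bullet> a)) *\<^sub>R a + (2 * \<epsilon> * (h \<bullet> b)) *\<^sub>R b)) (at q)"
proof -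
  have c: "cos (q \<bullet> a - y0) \<noteq> 0" using cos_pos_slab[OF assms] by simp
  have y: "((\<lambda>q. q \<bullet> a - y0) has_derivative (\<lambda>h. h \<bullet> a)) (at q)"
    by (auto intro!: derivative_eq_intros)
  have tan: "(tan has_real_derivative 1 + (tan (q \<bullet> a - y0))\<^sup>2) (at (q \<bullet> a - y0))"
    using DERIV_tan[OF c] tan_sec[OF c] by (simp only: power_inverse)
  note t = DERIV_compose_FDERIV[OF tan y]
  have b: "((\<lambda>q. 2 * \<epsilon> * (q \<bullet> b)) has_derivative (\<lambda>h. 2 * \<epsilon> * (h \<bullet> b))) (at q)"
    by (auto intro!: derivative_eq_intros)
  show ?thesis unfolding grim_grad_def[abs_def]
    by (rule has_derivative_eq_rhs[OF has_derivative_add[OF has_derivative_diff[OF has_derivative_const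
          has_derivative_scaleR_left[OF t]] has_derivative_scaleR_left[OF b]]]) (simp add: mult.commute)
qed

section \<open>Maximum principle for the barrier on a translator\<close>

text \<open>Multiplying the translator equation by \<open>W\<close> leaves the trace of the Hessian
  with respect to the inverse metric, the same expression that the tangent frame produces.\<close>

lemma translator_trace_eq:
  fixes e x :: "'a::euclidean_space"
  assumes eq: "translator_eq v e u x"
    and A: "(grad (u \<circ> proj_perp e) has_derivative A) (at x)"
  defines "p \<equiv> grad (u \<circ> proj_perp e) x"
  shows "(\<Sum>b\<in>Basis. A b \<bullet> b) - (A p \<bullet> p) / (1 + p \<bullet> p) = v \<bullet> (e - p)"
proof -
  define W where "W = sqrt (1 + (norm p)\<^sup>2)"
  have W: "W > 0" "W\<^sup>2 = 1 + p \<bullet> p" by (auto simp: W_def power2_norm_eq_inner add_pos_nonneg)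
  have "(\<Sum>b\<in>Basis. A b \<bullet> b) / W - (A p \<bullet> p) / W ^ 3 = (v \<bullet> (e - p)) / W"
    using eq div_field_normalized[OF A]
    by (simp add: translator_eq_def Let_def graph_normal_def p_def W_def)
  then have "W * ((\<Sum>b\<in>Basis. A b \<bullet> b) / W - (A p \<bullet> p) / W ^ 3) = W * ((v \<bullet> (e - p)) / W)"
    by simp
  moreover have "W * ((A p \<bullet> p) / W ^ 3) = (A p \<bullet> p) / W\<^sup>2"
    using W(1) by (simp add: power2_eq_square power3_eq_cube)
  ultimately show ?thesis using W by (simp add: right_diff_distrib)
qed

text \<open>First and second derivatives of the barrier along graph curves in the chart carrying the
  translator equation supply the hypotheses \<open>normal\<close> and \<open>nonpos\<close> of
  \<open>grim_reaper_trace_contradiction\<close>.\<close>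

lemma no_interior_max_grim_barrier:
  fixes M :: "'a::euclidean_space set" and v a b :: 'a
  assumes dim: "DIM('a) \<ge> 2" and M: "translator v M" and p: "p \<in> M" "p \<notin> mfd_boundary M"
    and norms: "norm v = 1" "norm a = 1" "norm b = 1"
    and orth: "a \<bullet> v = 0" "b \<bullet> v = 0" "b \<bullet> a = 0"
    and slab: "\<bar>p \<bullet> a - y0\<bar> < pi / 2"
    and \<epsilon>: "\<epsilon> > 0" "2 * \<epsilon> * (p \<bullet> b)\<^sup>2 < 1"
    and max: "\<And>q. q \<in> M \<Longrightarrow> \<bar>q \<bullet> a - y0\<bar> < pi / 2 \<Longrightarrow>
      grim_barrier v a y0 b \<epsilon> q \<le> grim_barrier v a y0 b \<epsilon> p"
  shows False
proof -
  let ?G = "grim_barrier v a y0 b \<epsilon>" and ?H = "grim_grad v a y0 b \<epsilon>"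
  define S where "S = {q. \<bar>q \<bullet> a - y0\<bar> < pi / 2}"
  have S: "open S" unfolding S_def by (intro open_Collect_less continuous_intros)
  obtain e' r' U' u' D' where chart': "interior_chart M p e' r' U' u' D'"
    using p by (auto simp: mfd_boundary_def)
  from M[unfolded translator_def] obtain \<nu> where "\<forall>p\<in>M. \<exists>e r U u D.
      (interior_chart M p e r U u D \<or> boundary_chart M p e r U u D) \<and>
      (\<forall>x\<in>D. graph_pt e u x \<in> ball p r \<longrightarrow>
         translator_eq v e u x \<and> (\<exists>s. \<nu> (graph_pt e u x) = s *\<^sub>R graph_normal e u x))"
    by (elim exE conjE)
  from bspec[OF this p(1)] obtain e r U u D
    where chart: "interior_chart M p e r U u D \<or> boundary_chart M p e r U u D"
      and "\<forall>x\<in>D. graph_pt e u x \<in> ball p r \<longrightarrow>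
         translator_eq v e u x \<and> (\<exists>s. \<nu> (graph_pt e u x) = s *\<^sub>R graph_normal e u x)"
    by (elim exE conjE)
  then have eq: "translator_eq v e u x" if "x \<in> D" "graph_pt e u x \<in> ball p r" for x
    using that by blast
  have "graph_chart M p e r U u D"
    using chart by (auto simp: interior_chart_def boundary_chart_def)
  then have e: "norm e = 1" and r: "r > 0" and U: "open U" and u: "smooth_on U u"
    and D: "D \<subseteq> U \<inter> hyperplane0 e" and MD: "M \<inter> ball p r = graph_pt e u ` D \<inter> ball p r"
    unfolding graph_chart_def by blast+
  obtain x n where x: "x \<in> D" and px: "p = graph_pt e u x" and n: "n \<noteq> 0" "n \<bullet> e = 0"
    and inward: "\<And>\<xi>. \<xi> \<bullet> e = 0 \<Longrightarrow> n \<bullet> \<xi> > 0 \<Longrightarrow> \<forall>\<^sub>F t in at_right 0. x + t *\<^sub>R \<xi> \<in> D"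
    using chart_inward_directions[OF dim chart] by blast
  let ?w = "u \<circ> proj_perp e"
  have xU: "x \<in> U" and xe: "x \<bullet> e = 0" using x D by (auto simp: hyperplane0_def)
  obtain A where A: "(grad ?w has_derivative A) (at x)" "\<And>h. A h \<bullet> e = 0"
    "\<And>h. A (proj_perp e h) = A h"
    using hessian_comp_proj_perp[OF e U u xU xe] by blast
  interpret A: bounded_linear A using A(1) by (rule has_derivative_bounded_linear)
  have ee: "e \<bullet> e = 1" using e by (simp add: norm_eq_sqrt_inner)
  have Ae: "A e = 0" using A(3)[of e] by (simp add: proj_perp_def ee A.zero)
  define g where "g = grad ?w x"
  have ge: "g \<bullet> e = 0" using grad_comp_proj_perp[OF e U u, of x] xU xe e
    by (simp add: g_def proj_perp_idem proj_perp_inner)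
  define N where "N = ?H p"
  define \<tau> where "\<tau> \<xi> = \<xi> + (g \<bullet> \<xi>) *\<^sub>R e" for \<xi>
  define c where "c \<xi> t = graph_pt e ?w (x + t *\<^sub>R \<xi>)" for \<xi> and t :: real
  have c0: "c \<xi> 0 = p" for \<xi> using px xe by (simp add: c_def graph_pt_def proj_perp_idem)
  have vel: "(c \<xi> has_vector_derivative \<xi> + (grad ?w (x + t *\<^sub>R \<xi>) \<bullet> \<xi>) *\<^sub>R e) (at t)"
    if "\<xi> \<bullet> e = 0" "x + t *\<^sub>R \<xi> \<in> U" for \<xi> t
    using graph_curve_has_vector_derivative[OF e U u xe that] by (simp add: c_def[abs_def])
  have vel0: "(c \<xi> has_vector_derivative \<tau> \<xi>) (at 0)" if "\<xi> \<bullet> e = 0" for \<xi>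
    using vel[OF that, of 0] xU by (simp add: \<tau>_def g_def)
  have near: "\<forall>\<^sub>F t in nhds 0. c \<xi> t \<in> V" if "\<xi> \<bullet> e = 0" "open V" "p \<in> V" for \<xi> V

  proof -
    have "(c \<xi> \<longlongrightarrow> p) (at 0)"
      using has_vector_derivative_continuous[OF vel0[OF that(1)]] by (simp add: isCont_def c0)
    then have "\<forall>\<^sub>F t in at 0. c \<xi> t \<in> V" using that(2,3) by (rule topological_tendstoD)
    then show ?thesis using that(3) c0 by (simp add: eventually_nhds_conv_at)
  qed
  have inM: "\<forall>\<^sub>F t in at_right 0. c \<xi> t \<in> M" if "\<xi> \<bullet> e = 0" "n \<bullet> \<xi> > 0" for \<xi>
  proof -
    have "\<forall>\<^sub>F t in at_right 0. c \<xi> t \<in> ball p r"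
      using near[OF that(1) open_ball, of p r] r
      by (simp add: eventually_nhds_conv_at eventually_at_split)
    with inward[OF that] show ?thesis
    proof eventually_elim
      case (elim t)
      have "c \<xi> t = graph_pt e u (x + t *\<^sub>R \<xi>)"
        using xe that by (simp add: c_def graph_pt_def proj_perp_idem inner_add_left)
      then show ?case using MD elim by blast
    qed
  qed
  have G: "(?G has_derivative (\<lambda>h. N \<bullet> h)) (at p)"
    unfolding N_def using slab by (rule has_derivative_grim_barrier)
  have crit_inward: "N \<bullet> \<tau> \<xi> = 0" if "\<xi> \<bullet> e = 0" "n \<bullet> \<xi> > 0" for \<xi>
    by (rule critical_along_right_curve[OF chart' G S _ _ vel0[OF that(1)] c0 inM[OF that]])
      (use slab max in \<open>auto simp: S_def\<close>)
  have nn: "n \<bullet> n > 0" using n(1) by simp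
  have crit: "N \<bullet> \<tau> \<xi> = 0" if "\<xi> \<bullet> e = 0" for \<xi>
  proof -
    \<comment> \<open>Adding this multiple of \<open>n\<close> makes the product with
      \<open>n\<close> at least 1, hence the direction inward; linearity of \<open>\<tau>\<close>
      then removes the added term.\<close>
    define k where "k = (1 + \<bar>n \<bullet> \<xi>\<bar>) / (n \<bullet> n)"
    have "n \<bullet> (\<xi> + k *\<^sub>R n) > 0" using nn by (simp add: inner_add_right k_def)
    then have "N \<bullet> \<tau> (\<xi> + k *\<^sub>R n) = 0"
      using that n(2) by (intro crit_inward) (simp_all add: inner_add_left)
    moreover have "\<tau> (\<xi> + k *\<^sub>R n) = \<tau> \<xi> + k *\<^sub>R \<tau> n"
      by (simp add: \<tau>_def inner_add_right algebra_simps)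
    moreover have "N \<bullet> \<tau> n = 0" using crit_inward[OF n(2) nn] .
    ultimately show ?thesis by (simp add: inner_add_right)
  qed
  define \<mu> where "\<mu> = N \<bullet> e"
  have N\<mu>: "N = \<mu> *\<^sub>R (e - g)"
  proof -
    \<comment> \<open>The difference lies in the hyperplane, and pairing \<open>N\<close> with its
      tangent lift \<open>\<tau> d\<close> gives exactly \<open>d \<bullet> d\<close>.\<close>
    define d where "d = N - \<mu> *\<^sub>R (e - g)"
    have de: "d \<bullet> e = 0" by (simp add: d_def inner_diff_left \<mu>_def ee ge)
    have "N \<bullet> \<tau> d = N \<bullet> d + \<mu> * (g \<bullet> d)"
      by (simp add: \<tau>_def inner_add_right \<mu>_def mult.commute)
    moreover have "d \<bullet> d = N \<bullet> d - \<mu> * (d \<bullet> e) + \<mu> * (g \<bullet> d)"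
      by (subst (1) d_def) (simp add: inner_diff_left inner_commute[of e d] right_diff_distrib)
    ultimately have "d \<bullet> d = 0" using crit[OF de] de by simp
    then show ?thesis by (simp add: d_def)
  qed
  define T where "T = tan (p \<bullet> a - y0)"
  \<comment> \<open>The second derivative at 0 of the barrier along \<open>c \<xi>\<close>: its
    Hessian on the velocity \<open>\<tau> \<xi>\<close>, plus its gradient paired with the
    acceleration \<open>(A \<xi> \<bullet> \<xi>) e\<close>, where
    \<open>\<mu> = N \<bullet> e\<close>.\<close>
  define Q where "Q \<xi> = - (1 + T\<^sup>2) * (a \<bullet> \<tau> \<xi>)\<^sup>2 + 2 * \<epsilon> * (b \<bullet> \<tau> \<xi>)\<^sup>2 + \<mu> * (A \<xi> \<bullet> \<xi>)" for \<xi>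
  have second_inward: "Q \<xi> \<le> 0" if \<xi>: "\<xi> \<bullet> e = 0" "n \<bullet> \<xi> > 0" for \<xi>
  proof (rule DERIV2_nonpos_if_right_max)
    let ?c' = "\<lambda>t. \<xi> + (grad ?w (x + t *\<^sub>R \<xi>) \<bullet> \<xi>) *\<^sub>R e"
    have cS: "\<forall>\<^sub>F t in nhds 0. c \<xi> t \<in> S" using near[OF \<xi>(1) S] slab by (simp add: S_def)
    have "\<forall>\<^sub>F t in nhds 0. x + t *\<^sub>R \<xi> \<in> U" using U xU by (rule eventually_line_in_open)
    with cS show "\<forall>\<^sub>F t in nhds 0. ((\<lambda>t. ?G (c \<xi> t)) has_real_derivative ?H (c \<xi> t) \<bullet> ?c' t) (at t)"
    proof eventually_elim
      case (elim t)
      have "((\<lambda>t. ?G (c \<xi> t)) has_derivative (\<lambda>h. ?H (c \<xi> t) \<bullet> (h *\<^sub>R ?c' t))) (at t)"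
        by (rule has_derivative_compose[OF vel[OF \<xi>(1) elim(2), unfolded has_vector_derivative_def]])
          (use elim in \<open>auto intro: has_derivative_grim_barrier simp: S_def\<close>)
      then show ?case by (simp add: has_field_derivative_def mult_commute_abs)
    qed
    have "((\<lambda>t. x + t *\<^sub>R \<xi>) has_derivative (\<lambda>h. h *\<^sub>R \<xi>)) (at (0::real))"
      by (auto intro!: derivative_eq_intros)
    from has_derivative_compose[OF this, of "grad ?w" A] A(1)
    have "((\<lambda>t. grad ?w (x + t *\<^sub>R \<xi>)) has_derivative (\<lambda>h. A (h *\<^sub>R \<xi>))) (at 0)" by simp
    then have c'': "(?c' has_derivative (\<lambda>h. (A (h *\<^sub>R \<xi>) \<bullet> \<xi>) *\<^sub>R e)) (at 0)"
      by (auto intro!: derivative_eq_intros)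
    have "((\<lambda>t. ?H (c \<xi> t)) has_derivative (\<lambda>h. - ((1 + T\<^sup>2) * ((h *\<^sub>R \<tau> \<xi>) \<bullet> a)) *\<^sub>R a
        + (2 * \<epsilon> * ((h *\<^sub>R \<tau> \<xi>) \<bullet> b)) *\<^sub>R b)) (at 0)"
      unfolding T_def
      by (rule has_derivative_compose[OF vel0[OF \<xi>(1), unfolded has_vector_derivative_def]])
        (use grim_grad_has_derivative[OF slab] c0 in simp)
    from has_derivative_inner[OF this c'']
    show "((\<lambda>t. ?H (c \<xi> t) \<bullet> ?c' t) has_real_derivative Q \<xi>) (at 0)"
      unfolding has_field_derivative_def
    proof (rule has_derivative_eq_rhs, intro ext)
      fix h :: real
      have "?c' 0 = \<tau> \<xi>" "?H (c \<xi> 0) = N" by (simp_all add: \<tau>_def g_def N_def c0)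
      then show "?H (c \<xi> 0) \<bullet> ((A (h *\<^sub>R \<xi>) \<bullet> \<xi>) *\<^sub>R e) + (- ((1 + T\<^sup>2) * ((h *\<^sub>R \<tau> \<xi>) \<bullet> a)) *\<^sub>R a
          + (2 * \<epsilon> * ((h *\<^sub>R \<tau> \<xi>) \<bullet> b)) *\<^sub>R b) \<bullet> ?c' 0 = Q \<xi> * h"
        by (simp add: A.scaleR \<mu>_def[symmetric] Q_def inner_add_left inner_commute[of "\<tau> \<xi>" a]
            inner_commute[of "\<tau> \<xi>" b] power2_eq_square del: o_apply) (simp add: algebra_simps)
    qed
    show "?H (c \<xi> 0) \<bullet> ?c' 0 = 0"
      using crit[OF \<xi>(1)] by (simp add: c0 N_def \<tau>_def g_def)
    have "\<forall>\<^sub>F t in at_right 0. c \<xi> t \<in> S" using cS by (simp add: eventually_nhds_conv_at eventually_at_split)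
    with inM[OF \<xi>] show "\<forall>\<^sub>F t in at_right 0. ?G (c \<xi> t) \<le> ?G (c \<xi> 0)"
      by eventually_elim (use max c0 in \<open>auto simp: S_def\<close>)
  qed
  \<comment> \<open>Such directions are limits of the inward directions \<open>\<xi> + s n\<close>,
    along which \<open>Q\<close> is a quadratic polynomial in \<open>s\<close>.\<close>
  have second_closed: "Q \<xi> \<le> 0" if \<xi>: "\<xi> \<bullet> e = 0" "n \<bullet> \<xi> \<ge> 0" for \<xi>
  proof (rule quadratic_perturbation_nonpos)
    fix s :: real assume "s > 0"
    have "Q (\<xi> + s *\<^sub>R n) \<le> 0"
      using \<xi> n(2) nn \<open>s > 0\<close> by (intro second_inward) (auto simp: inner_add_left inner_add_right add_nonneg_pos)
    moreover have \<tau>: "\<tau> (\<xi> + s *\<^sub>R n) = \<tau> \<xi> + s *\<^sub>R \<tau> n"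
      by (simp add: \<tau>_def inner_add_right algebra_simps)
    have sq: "(z \<bullet> (y1 + s *\<^sub>R y2))\<^sup>2 = (z \<bullet> y1)\<^sup>2 + s * (2 * (z \<bullet> y1) * (z \<bullet> y2)) + s\<^sup>2 * (z \<bullet> y2)\<^sup>2"
      for z y1 y2 :: 'a
      by (simp add: inner_add_right power2_eq_square algebra_simps)
    have hess: "A (\<xi> + s *\<^sub>R n) \<bullet> (\<xi> + s *\<^sub>R n) =
        A \<xi> \<bullet> \<xi> + s * (A \<xi> \<bullet> n + A n \<bullet> \<xi>) + s\<^sup>2 * (A n \<bullet> n)"
      by (simp add: A.add A.scaleR inner_add_left inner_add_right power2_eq_square algebra_simps)
    have "Q (\<xi> + s *\<^sub>R n) = Q \<xi> + s * (- 2 * (1 + T\<^sup>2) * (a \<bullet> \<tau> \<xi>) * (a \<bullet> \<tau> n)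
        + 4 * \<epsilon> * (b \<bullet> \<tau> \<xi>) * (b \<bullet> \<tau> n) + \<mu> * (A \<xi> \<bullet> n + A n \<bullet> \<xi>)) + s\<^sup>2 * Q n"
      unfolding Q_def \<tau> sq hess by (simp add: algebra_simps)
    ultimately show "Q \<xi> + s * (- 2 * (1 + T\<^sup>2) * (a \<bullet> \<tau> \<xi>) * (a \<bullet> \<tau> n)
        + 4 * \<epsilon> * (b \<bullet> \<tau> \<xi>) * (b \<bullet> \<tau> n) + \<mu> * (A \<xi> \<bullet> n + A n \<bullet> \<xi>)) + s\<^sup>2 * Q n \<le> 0"
      by simp
  qed
  have second: "Q \<xi> \<le> 0" if "\<xi> \<bullet> e = 0" for \<xi>
  proof (cases "n \<bullet> \<xi> \<ge> 0")
    case False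
    have "\<tau> (- \<xi>) = - \<tau> \<xi>" by (simp add: \<tau>_def)
    then have "Q (- \<xi>) = Q \<xi>" by (simp add: Q_def A.neg)
    then show ?thesis using second_closed[of "- \<xi>"] that False by simp
  qed (use second_closed that in auto)
  have "translator_eq v e u x" using eq[OF x] px r by simp
  from translator_trace_eq[OF this A(1)]
  have tr: "(\<Sum>b\<in>Basis. A b \<bullet> b) - (A g \<bullet> g) / (1 + g \<bullet> g) = v \<bullet> (e - g)"
    by (simp add: g_def)
  \<comment> \<open>The barrier grows at unit rate along \<open>v\<close>, since \<open>a\<close>
    and \<open>b\<close> are orthogonal to \<open>v\<close>. This normalizes the right side of the
    trace equation to 1.\<close>
  have "N \<bullet> v = 1"
    using norms(1) orth by (simp add: N_def grim_grad_def inner_add_left inner_diff_left norm_eq_sqrt_inner)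
  then have "\<mu> * (v \<bullet> (e - g)) = 1" by (simp add: N\<mu> inner_commute)
  then have "\<mu> * ((\<Sum>b\<in>Basis. A b \<bullet> b) - (A g \<bullet> g) / (1 + g \<bullet> g)) = 1" unfolding tr .
  note trace = this
  have normal: "v - T *\<^sub>R a + (2 * \<epsilon> * (p \<bullet> b)) *\<^sub>R b = \<mu> *\<^sub>R (e - g)"
    unfolding N\<mu>[symmetric] by (simp add: N_def grim_grad_def T_def)
  show False
    by (rule grim_reaper_trace_contradiction[OF norms e orth ge A.linear A(2) Ae normal trace
          second[unfolded Q_def \<tau>_def] \<epsilon>])
qed

lemma grim_barrier_attains_max:
  fixes M :: "'a::euclidean_space set"
  assumes M: "compact M" and q0: "q0 \<in> M" "\<bar>q0 \<bullet> a - y0\<bar> < pi / 2"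
  obtains p where "p \<in> M" "\<bar>p \<bullet> a - y0\<bar> < pi / 2"
    "\<And>q. q \<in> M \<Longrightarrow> \<bar>q \<bullet> a - y0\<bar> < pi / 2 \<Longrightarrow>
      grim_barrier v a y0 b \<epsilon> q \<le> grim_barrier v a y0 b \<epsilon> p"
proof -
  \<comment> \<open>The exponential of the barrier extends continuously by \<open>0\<close> to the closed slab.\<close>
  define E where "E q = exp (q \<bullet> v + \<epsilon> * (q \<bullet> b)\<^sup>2) * cos (q \<bullet> a - y0)" for q
  define K where "K = M \<inter> {q. \<bar>q \<bullet> a - y0\<bar> \<le> pi / 2}"
  have "closed {q. \<bar>q \<bullet> a - y0\<bar> \<le> pi / 2}"
    by (intro closed_Collect_le continuous_intros)
  with M have "compact K" unfolding K_def by (rule compact_Int_closed)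
  moreover have "K \<noteq> {}" using q0 by (auto simp: K_def)
  moreover have "continuous_on K E" unfolding E_def by (intro continuous_intros)
  ultimately have "\<exists>p\<in>K. \<forall>q\<in>K. E q \<le> E p" by (rule continuous_attains_sup)
  then obtain p where p: "p \<in> K" "\<And>q. q \<in> K \<Longrightarrow> E q \<le> E p" by blast
  have E: "E q > 0" "grim_barrier v a y0 b \<epsilon> q = ln (E q)" if "\<bar>q \<bullet> a - y0\<bar> < pi / 2" for q
    using cos_pos_slab[OF that] by (simp_all add: E_def grim_barrier_def ln_mult)
  \<comment> \<open>The value at \<open>q0\<close> is positive, which keeps the maximum point off
    the faces of the slab, where the cosine vanishes.\<close>
  have "E p > 0" using E(1)[OF q0(2)] p(2)[of q0] q0 by (auto simp: K_def)
  then have "cos \<bar>p \<bullet> a - y0\<bar> \<noteq> 0" by (auto simp: E_def)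
  then have "\<bar>p \<bullet> a - y0\<bar> \<noteq> pi / 2" using cos_pi_half by metis
  then have slab: "\<bar>p \<bullet> a - y0\<bar> < pi / 2" using p(1) by (simp add: K_def)
  show thesis
  proof (rule that[OF _ slab])
    show "p \<in> M" using p(1) by (simp add: K_def)
    fix q assume q: "q \<in> M" "\<bar>q \<bullet> a - y0\<bar> < pi / 2"
    then have "E q \<le> E p" by (intro p(2)) (simp add: K_def)
    then show "grim_barrier v a y0 b \<epsilon> q \<le> grim_barrier v a y0 b \<epsilon> p"
      using E[OF q(2)] E[OF slab] by simp
  qed
qed

section \<open>The slab between the two convex bodies\<close>

text \<open>From a relatively interior point one could move a little towards \<open>k2\<close>
  inside the common affine hull, staying in \<open>K1\<close> and reducing the distance.\<close>

lemma nearest_point_in_rel_frontier: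
  fixes K1 K2 :: "'a::euclidean_space set"
  assumes K: "closed K1" "K1 \<inter> K2 = {}"
    and P: "affine hull K1 = P" "affine hull K2 = P"
    and k: "k1 \<in> K1" "k2 \<in> K2" and min: "\<And>x y. x \<in> K1 \<Longrightarrow> y \<in> K2 \<Longrightarrow> dist k1 k2 \<le> dist x y"
  shows "k1 \<in> rel_frontier K1"
proof (rule ccontr)
  assume "k1 \<notin> rel_frontier K1"
  then have "k1 \<in> rel_interior K1"
    using k(1) K(1) by (simp add: rel_frontier_def)
  then obtain d where d: "d > 0" "ball k1 d \<inter> P \<subseteq> K1"
    using P(1) by (auto simp: mem_rel_interior_ball)
  have ne: "k1 \<noteq> k2" using k K(2) by auto
  \<comment> \<open>The step covers at most half the radius \<open>d\<close>, and the cap at 1 keeps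
    \<open>x\<close> from passing beyond \<open>k2\<close>.\<close>
  define t where "t = min 1 (d / (2 * dist k1 k2))"
  have t: "0 < t" "t \<le> 1" "t * dist k1 k2 < d"
    using d(1) ne by (auto simp: t_def min_def field_simps)
  define x where "x = k1 + t *\<^sub>R (k2 - k1)"
  have "k1 \<in> P" "k2 \<in> P" using k P hull_inc by metis+
  then have "x \<in> P"
    using mem_affine[OF affine_affine_hull[of K1, unfolded P(1)], of k1 k2 "1 - t" t]
    by (simp add: x_def algebra_simps)
  moreover have "dist k1 x = t * dist k1 k2"
    using t(1) by (simp add: x_def dist_norm norm_minus_commute)
  ultimately have "x \<in> K1" using d(2) t(3) by auto
  from min[OF this k(2)] have "dist k1 k2 \<le> dist x k2" .
  also have "x - k2 = (1 - t) *\<^sub>R (k1 - k2)" by (simp add: x_def algebra_simps)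
  then have "dist x k2 = (1 - t) * dist k1 k2" using t(2) by (simp add: dist_norm)
  finally have "t * dist k1 k2 \<le> 0" by (simp add: algebra_simps)
  moreover have "t * dist k1 k2 > 0" using t(1) ne by simp
  ultimately show False by simp
qed

text \<open>The distance bound concerns only the frontiers. It passes to the bodies once they are
  known to be disjoint, because their nearest points then lie on the frontiers. The slab is
  orthogonal to the segment joining those points.\<close>

lemma separating_slab:
  fixes v :: "'a::euclidean_space"
  assumes dim: "DIM('a) \<ge> 3" and v: "v \<noteq> 0"
    and K1: "strictly_convex_hypersurface_of {x. x \<bullet> v = c} K1 \<Gamma>1"
    and K2: "strictly_convex_hypersurface_of {x. x \<bullet> v = c} K2 \<Gamma>2"
    and dist: "setdist \<Gamma>1 \<Gamma>2 \<ge> \<delta>" "\<delta> > 0"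
    and nsub: "\<not> \<Gamma>1 \<subseteq> K2" "\<not> \<Gamma>2 \<subseteq> K1"
  obtains a y0 where "norm a = 1" "a \<bullet> v = 0"
    "\<And>x. x \<in> K1 \<Longrightarrow> x \<bullet> a \<le> y0 - \<delta> / 2" "\<And>x. x \<in> K2 \<Longrightarrow> x \<bullet> a \<ge> y0 + \<delta> / 2"
proof -
  note f1 = strictly_convex_hypersurface_facts[OF dim v K1]
  note f2 = strictly_convex_hypersurface_facts[OF dim v K2]
  have closed: "closed K1" "closed K2" using f1(1) f2(1) by (auto intro: compact_imp_closed)
  have ne: "K1 \<noteq> {}" "K2 \<noteq> {}" using f1(3,4) f2(3,4) by auto
  have dG: "dist x y \<ge> \<delta>" if "x \<in> \<Gamma>1" "y \<in> \<Gamma>2" for x y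
    using setdist_le_dist[OF that] dist(1) by simp
  then have disjG: "\<Gamma>1 \<inter> \<Gamma>2 = {}" using dist(2) by force
  \<comment> \<open>The connected set \<open>\<Gamma>1\<close> avoids \<open>\<Gamma>2\<close> and
    is not inside \<open>K2\<close>, so it misses \<open>K2\<close>. Hence \<open>K2\<close> avoids
    the frontier of \<open>K1\<close> and lies inside or outside \<open>K1\<close>; inside is
    excluded by \<open>\<Gamma>2\<close>.\<close>
  have "\<Gamma>1 \<subseteq> affine hull K2" using f1(3,6) f2(7) by auto
  then have "\<Gamma>1 \<inter> K2 = {}"
    using connected_disjoint_rel_frontier[OF f1(5) _ closed(2)] disjG nsub(1) f2(8) by auto
  then have "K2 \<inter> rel_frontier K1 = {}" using f1(8) by auto
  moreover have "K2 \<subseteq> affine hull K1" using f2(6) f1(7) by auto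
  ultimately have "K2 \<subseteq> K1 \<or> K2 \<inter> K1 = {}"
    using connected_disjoint_rel_frontier[OF convex_connected[OF f2(2)] _ closed(1)] by blast
  then have disj: "K1 \<inter> K2 = {}" using nsub(2) f2(3) by auto
  obtain k1 k2 where k: "k1 \<in> K1" "k2 \<in> K2" "dist k1 k2 = setdist K1 K2"
    using setdist_compact_closed[OF f1(1) closed(2) ne] by blast
  have min: "dist k1 k2 \<le> dist x y" if "x \<in> K1" "y \<in> K2" for x y
    using setdist_le_dist[OF that] k(3) by simp
  have "k1 \<in> \<Gamma>1" unfolding f1(8)
    by (rule nearest_point_in_rel_frontier[OF closed(1) disj f1(7) f2(7) k(1,2) min])
  moreover have "dist k2 k1 \<le> dist x y" if "x \<in> K2" "y \<in> K1" for x y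
    using min[OF that(2,1)] by (simp add: dist_commute)
  then have "k2 \<in> \<Gamma>2" unfolding f2(8)
    using disj by (intro nearest_point_in_rel_frontier[OF closed(2) _ f2(7) f1(7) k(2,1)]) auto
  ultimately have d: "dist k1 k2 \<ge> \<delta>" by (rule dG)
  define l where "l = dist k1 k2"
  have l: "l \<ge> \<delta>" "l > 0" using d dist(2) by (auto simp: l_def)
  define a where "a = (k2 - k1) /\<^sub>R l"
  \<comment> \<open>Midpoint of the levels of the two nearest points, which are
    \<open>l \<ge> \<delta>\<close> apart.\<close>
  define y0 where "y0 = (k1 \<bullet> a + k2 \<bullet> a) / 2"
  have "(k2 - k1) \<bullet> (k2 - k1) = l * l"
    by (simp add: l_def dist_norm norm_minus_commute power2_norm_eq_inner[symmetric] power2_eq_square)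
  then have gap: "k2 \<bullet> a - k1 \<bullet> a = l" using l(2)
    by (simp add: a_def right_diff_distrib[symmetric] inner_diff_left[symmetric])
  show thesis
  proof
    show "norm a = 1" using l(2) by (simp add: a_def l_def dist_norm norm_minus_commute)
    have "k1 \<bullet> v = c" "k2 \<bullet> v = c" using k f1(6) f2(6) by auto
    then show "a \<bullet> v = 0" by (simp add: a_def inner_diff_left)
    show "x \<bullet> a \<le> y0 - \<delta> / 2" if "x \<in> K1" for x
    proof -
      \<comment> \<open>Variational inequality for the nearest point: \<open>K1\<close> lies behind
        the hyperplane through \<open>k1\<close> with normal \<open>k2 - k1\<close>.\<close>
      have "(k2 - k1) \<bullet> (x - k1) \<le> 0"
        by (rule any_closest_point_dot[OF f1(2) closed(1) k(1) that]) (use min k in \<open>auto simp: dist_commute\<close>)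
      then have "(k2 - k1) \<bullet> x \<le> (k2 - k1) \<bullet> k1" by (simp add: inner_diff_right)
      then have "x \<bullet> a \<le> k1 \<bullet> a" using l(2)
        by (simp only: a_def inner_scaleR_right inner_commute[of x "k2 - k1"] inner_commute[of k1 "k2 - k1"] mult_left_mono
            inverse_nonnegative_iff_nonnegative less_imp_le)
      then show ?thesis using gap l(1) by (simp add: y0_def field_simps)
    qed
    show "x \<bullet> a \<ge> y0 + \<delta> / 2" if "x \<in> K2" for x
    proof -
      have "(k1 - k2) \<bullet> (x - k2) \<le> 0"
        by (rule any_closest_point_dot[OF f2(2) closed(2) k(2) that]) (use min k in auto)
      then have "(k2 - k1) \<bullet> k2 \<le> (k2 - k1) \<bullet> x" by (simp add: inner_diff_left inner_diff_right)
      then have "x \<bullet> a \<ge> k2 \<bullet> a" using l(2)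
        by (simp only: a_def inner_scaleR_right inner_commute[of x "k2 - k1"] inner_commute[of k2 "k2 - k1"] mult_left_mono
            inverse_nonnegative_iff_nonnegative less_imp_le)
      then show ?thesis using gap l(1) by (simp add: y0_def field_simps)
    qed
  qed
qed

section \<open>Placing the barrier between the two boundary components\<close>

theorem mainTheorem2:
  fixes v :: "'a::euclidean_space"
  assumes "DIM('a) \<ge> 3" and "norm v = 1"
  shows "\<not> (\<exists>M c \<Gamma>1 \<Gamma>2 K1 K2.
            translator v M \<and> connected M \<and> compact M \<and>
            mfd_boundary M \<subseteq> {x. x \<bullet> v = c} \<and>
            mfd_boundary M = \<Gamma>1 \<union> \<Gamma>2 \<and>
            strictly_convex_hypersurface_of {x. x \<bullet> v = c} K1 \<Gamma>1 \<and>
            strictly_convex_hypersurface_of {x. x \<bullet> v = c} K2 \<Gamma>2 \<and>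
            setdist \<Gamma>1 \<Gamma>2 \<ge> pi \<and>
            \<not> \<Gamma>1 \<subseteq> K2 \<and> \<not> \<Gamma>2 \<subseteq> K1)"
proof (rule notI, elim exE conjE)
  fix M c \<Gamma>1 \<Gamma>2 K1 K2
  assume M: "translator v M" "connected M" "compact M" and bd: "mfd_boundary M = \<Gamma>1 \<union> \<Gamma>2"
    and K: "strictly_convex_hypersurface_of {x. x \<bullet> v = c} K1 \<Gamma>1"
      "strictly_convex_hypersurface_of {x. x \<bullet> v = c} K2 \<Gamma>2"
    and dist: "setdist \<Gamma>1 \<Gamma>2 \<ge> pi" and nsub: "\<not> \<Gamma>1 \<subseteq> K2" "\<not> \<Gamma>2 \<subseteq> K1"
  have v: "v \<noteq> 0" using assms(2) by auto
  note f1 = strictly_convex_hypersurface_facts[OF assms(1) v K(1)]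
  note f2 = strictly_convex_hypersurface_facts[OF assms(1) v K(2)]
  obtain a y0 where a: "norm a = 1" "a \<bullet> v = 0"
    and left: "\<And>x. x \<in> K1 \<Longrightarrow> x \<bullet> a \<le> y0 - pi / 2" and right: "\<And>x. x \<in> K2 \<Longrightarrow> x \<bullet> a \<ge> y0 + pi / 2"
    using separating_slab[OF assms(1) v K dist pi_gt_zero nsub] by blast
  have "dim {v, a} \<le> card {v, a}" by (rule dim_le_card) (auto simp: span_superset)
  also have "\<dots> < DIM('a)" using assms(1) by (auto simp: card_insert_if)
  finally obtain b' where b': "b' \<noteq> 0" "\<And>y. y \<in> span {v, a} \<Longrightarrow> orthogonal b' y"
    using orthogonal_to_subspace_exists by metis
  define b where "b = b' /\<^sub>R norm b'"
  have b: "norm b = 1" "b \<bullet> v = 0" "b \<bullet> a = 0"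
    using b'(1) b'(2)[of v] b'(2)[of a] by (auto simp: b_def orthogonal_def span_base)
  have bdM: "mfd_boundary M \<subseteq> M" by (auto simp: mfd_boundary_def)
  obtain x1 x2 where x: "x1 \<in> \<Gamma>1" "x2 \<in> \<Gamma>2" using f1(4) f2(4) by auto
  have "a \<bullet> x1 \<le> y0" "y0 \<le> a \<bullet> x2"
  proof -
    have "x1 \<in> K1" "x2 \<in> K2" using x f1(3) f2(3) by auto
    from left[OF this(1)] right[OF this(2)] show "a \<bullet> x1 \<le> y0" "y0 \<le> a \<bullet> x2"
      using pi_half_gt_zero unfolding inner_commute[of a] by linarith+
  qed
  \<comment> \<open>The two boundary components lie on opposite sides of the middle hyperplane of
    the slab, so the connected set \<open>M\<close> crosses it.\<close>
  then obtain q0 where q0: "q0 \<in> M" "a \<bullet> q0 = y0"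
    using connected_ivt_hyperplane[OF M(2), of x1 x2 a y0] x bd bdM by auto
  obtain B where B: "B > 0" "\<And>q. q \<in> M \<Longrightarrow> norm q \<le> B"
    using compact_imp_bounded[OF M(3)] by (auto simp: bounded_pos)
  \<comment> \<open>With this value \<open>2 * \<epsilon> * (q \<bullet> b)\<^sup>2\<close> is at
    most 1/2 on all of \<open>M\<close>, so the smallness condition holds wherever the maximum
    occurs.\<close>
  define \<epsilon> where "\<epsilon> = 1 / (4 * B\<^sup>2)"
  have \<epsilon>: "\<epsilon> > 0" using B(1) by (simp add: \<epsilon>_def)
  have \<epsilon>2: "2 * \<epsilon> * (q \<bullet> b)\<^sup>2 < 1" if "q \<in> M" for q
  proof -
    have "\<bar>q \<bullet> b\<bar> \<le> B" using Cauchy_Schwarz_ineq2[of q b] B(2)[OF that] b(1) by simp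
    then have "(q \<bullet> b)\<^sup>2 \<le> B\<^sup>2" using B(1) by (simp add: abs_le_square_iff[symmetric])
    then have "2 * \<epsilon> * (q \<bullet> b)\<^sup>2 \<le> 2 * \<epsilon> * B\<^sup>2" using \<epsilon> by simp
    also have "\<dots> < 1" using B(1) by (simp add: \<epsilon>_def)
    finally show ?thesis .
  qed
  obtain p where p: "p \<in> M" "\<bar>p \<bullet> a - y0\<bar> < pi / 2"
    and max: "\<And>q. q \<in> M \<Longrightarrow> \<bar>q \<bullet> a - y0\<bar> < pi / 2 \<Longrightarrow>
      grim_barrier v a y0 b \<epsilon> q \<le> grim_barrier v a y0 b \<epsilon> p"
  proof -
    have "\<bar>q0 \<bullet> a - y0\<bar> < pi / 2" using q0(2) by (simp add: inner_commute)
    from grim_barrier_attains_max[OF M(3) q0(1) this, of v b \<epsilon>] show ?thesis using that by blast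
  qed
  \<comment> \<open>The maximum point is strictly inside the slab while both bodies lie on or beyond
    its faces, so it avoids \<open>\<Gamma>1\<close> and \<open>\<Gamma>2\<close>.\<close>
  have "p \<notin> K1" "p \<notin> K2" using p(2) left[of p] right[of p] by linarith+
  then have "p \<notin> mfd_boundary M" using f1(3) f2(3) bd by auto
  then show False
    using no_interior_max_grim_barrier[OF _ M(1) p(1) _ assms(2) a(1) b(1) a(2) b(2,3) p(2) \<epsilon> \<epsilon>2[OF p(1)]]
      max assms(1) by simp
qed

end
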